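(* The decision problem MONOPHONIC POSITION SET is NP-hard, where the problem is: given a graph $G$ and a positive integer $k \leq |V(G)|$, decide whether there is a monophonic position set $S$ of $G$ such that $|S| \geq k$.
   Context: All graphs are finite, simple and undirected. A path $P$ in $G$ is monophonic (induced) if $G$ contains no edge between vertices that are non-consecutive on $P$. A set $S \subseteq V(G)$ is a monophonic position set of $G$ if no three vertices of $S$ lie on a common monophonic path in $G$. NP-hardness is with respect to polynomial-time reductions. *)

theory Defs
  imports Main "HOL-Computational_Algebra.Polynomial"
begin

section \<open>Finite simple graphs and monophonic position sets\<close>

text \<open>A graph is a pair of a vertex set and a set of edges, each edge being a set of two vertices.\<close>

type_synonym 'a graph = "'a set \<times> 'a set set"

definition simple_graph :: "'a graph \<Rightarrow> bool" where
  "simple_graph G \<longleftrightarrow> (case G of (V, E) \<Rightarrow>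
     finite V \<and> (\<forall>e\<in>E. \<exists>u\<in>V. \<exists>v\<in>V. u \<noteq> v \<and> e = {u, v}))"

definition is_path :: "'a graph \<Rightarrow> 'a list \<Rightarrow> bool" where
  "is_path G p \<longleftrightarrow> (case G of (V, E) \<Rightarrow>
     p \<noteq> [] \<and> set p \<subseteq> V \<and> distinct p \<and>
     (\<forall>i. Suc i < length p \<longrightarrow> {p ! i, p ! Suc i} \<in> E))"

definition monophonic_path :: "'a graph \<Rightarrow> 'a list \<Rightarrow> bool" where
  "monophonic_path G p \<longleftrightarrow> is_path G p \<and>
     (\<forall>i j. i < j \<and> j < length p \<and> j \<noteq> Suc i \<longrightarrow> {p ! i, p ! j} \<notin> snd G)"

definition monophonic_position_set :: "'a graph \<Rightarrow> 'a set \<Rightarrow> bool" where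
  "monophonic_position_set G S \<longleftrightarrow> S \<subseteq> fst G \<and>
     \<not> (\<exists>u\<in>S. \<exists>v\<in>S. \<exists>w\<in>S. u \<noteq> v \<and> v \<noteq> w \<and> u \<noteq> w \<and>
          (\<exists>p. monophonic_path G p \<and> {u, v, w} \<subseteq> set p))"


section \<open>Nondeterministic multi-tape Turing machines\<close>

text \<open>
  States and tape symbols are natural numbers; since the transition set is finite, only finitely
  many of them matter. Symbol 0 is the blank. A transition \<open>(q, as, q', acts)\<close> is applicable in
  state \<open>q\<close> if tape number \<open>i\<close> shows the symbol \<open>as ! i\<close> under its head, for every \<open>i\<close>; it
  changes the state to \<open>q'\<close> and on tape \<open>i\<close> writes the first component of \<open>acts ! i\<close> and then
  moves the head as its second component says. Tapes are infinite in both directions.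
\<close>

datatype move = Left | Stay | Right

type_synonym transition = "nat \<times> nat list \<times> nat \<times> (nat \<times> move) list"

record tm =
  tape_count :: nat
  transitions :: "transition set"
  start_state :: nat
  accept_state :: nat

definition tm_wf :: "tm \<Rightarrow> bool" where
  "tm_wf M \<longleftrightarrow> tape_count M \<ge> 1 \<and> finite (transitions M) \<and>
     (\<forall>(q, as, q', acts) \<in> transitions M.
        length as = tape_count M \<and> length acts = tape_count M)"

definition deterministic :: "tm \<Rightarrow> bool" where
  "deterministic M \<longleftrightarrow>
     (\<forall>q as q1 acts1 q2 acts2.
        (q, as, q1, acts1) \<in> transitions M \<and> (q, as, q2, acts2) \<in> transitions M \<longrightarrow>
        q1 = q2 \<and> acts1 = acts2)"

text \<open>A tape is given by its contents and the position of its head.\<close>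

type_synonym tape = "(int \<Rightarrow> nat) \<times> int"
type_synonym config = "nat \<times> tape list"

fun read_tape :: "tape \<Rightarrow> nat" where
  "read_tape (f, h) = f h"

fun shift_head :: "move \<Rightarrow> int \<Rightarrow> int" where
  "shift_head Left h = h - 1"
| "shift_head Stay h = h"
| "shift_head Right h = h + 1"

fun act_tape :: "nat \<times> move \<Rightarrow> tape \<Rightarrow> tape" where
  "act_tape (b, d) (f, h) = (f(h := b), shift_head d h)"

definition step :: "tm \<Rightarrow> config \<Rightarrow> config \<Rightarrow> bool" where
  "step M c c' \<longleftrightarrow>
     (\<exists>q' acts. (fst c, map read_tape (snd c), q', acts) \<in> transitions M \<and>
        c' = (q', map2 act_tape acts (snd c)))"

definition halted :: "tm \<Rightarrow> config \<Rightarrow> bool" where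
  "halted M c \<longleftrightarrow> \<not> (\<exists>c'. step M c c')"

text \<open>The bits of a word occupy the cells \<open>0, 1, \<dots>\<close>; all other cells are blank.\<close>

definition word_tape :: "bool list \<Rightarrow> int \<Rightarrow> nat" where
  "word_tape w i =
     (if 0 \<le> i \<and> i < int (length w) then (if w ! nat i then 2 else 1) else 0)"

text \<open>The input is on tape 0, all other tapes are blank, and all heads are on cell 0.\<close>

definition init_config :: "tm \<Rightarrow> bool list \<Rightarrow> config" where
  "init_config M w =
     (start_state M, (word_tape w, 0) # replicate (tape_count M - 1) (word_tape [], 0))"


section \<open>Polynomial time, NP, and NP-hardness\<close>

type_synonym language = "bool list set"

text \<open>All computation branches of \<open>M\<close> halt within the time bound, and the words in \<open>A\<close> are those
  on which some branch halts in the accepting state.\<close>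

definition decides_in_time :: "tm \<Rightarrow> language \<Rightarrow> (nat \<Rightarrow> nat) \<Rightarrow> bool" where
  "decides_in_time M A T \<longleftrightarrow> (\<forall>w.
     (\<forall>m c. (step M ^^ m) (init_config M w) c \<longrightarrow> m \<le> T (length w)) \<and>
     (w \<in> A \<longleftrightarrow>
        (\<exists>c. (step M)\<^sup>*\<^sup>* (init_config M w) c \<and> halted M c \<and> fst c = accept_state M)))"

definition NP :: "language set" where
  "NP = {A. \<exists>M (p :: nat poly). tm_wf M \<and> decides_in_time M A (poly p)}"

text \<open>A function is computed by a machine that halts with the function value on tape 1.
  The final state and head positions are irrelevant.\<close>

definition computes_in_time ::
  "tm \<Rightarrow> (bool list \<Rightarrow> bool list) \<Rightarrow> (nat \<Rightarrow> nat) \<Rightarrow> bool" where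
  "computes_in_time M f T \<longleftrightarrow> (\<forall>w. \<exists>m c.
     m \<le> T (length w) \<and> (step M ^^ m) (init_config M w) c \<and> halted M c \<and>
     fst (snd c ! 1) = word_tape (f w))"

definition polytime_computable :: "(bool list \<Rightarrow> bool list) \<Rightarrow> bool" where
  "polytime_computable f \<longleftrightarrow>
     (\<exists>M (p :: nat poly). tm_wf M \<and> deterministic M \<and> tape_count M \<ge> 2 \<and>
        computes_in_time M f (poly p))"

definition polytime_reducible :: "language \<Rightarrow> language \<Rightarrow> bool" where
  "polytime_reducible A B \<longleftrightarrow>
     (\<exists>f. polytime_computable f \<and> (\<forall>w. w \<in> A \<longleftrightarrow> f w \<in> B))"

definition NP_hard :: "language \<Rightarrow> bool" where
  "NP_hard B \<longleftrightarrow> (\<forall>A\<in>NP. polytime_reducible A B)"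


section \<open>The decision problem\<close>

text \<open>
  An instance consists of a graph with vertex set \<open>{..<n}\<close> (up to isomorphism, every finite
  graph is of this form), edge set \<open>E\<close>, and a number \<open>k\<close>.
  It is written as \<open>n\<close> in unary, \<open>k\<close> in unary, and the adjacency matrix row by row. As
  \<open>k \<le> n\<close>, the choice between unary and binary changes the input length only polynomially.
\<close>

definition encode_instance :: "nat \<Rightarrow> nat set set \<Rightarrow> nat \<Rightarrow> bool list" where
  "encode_instance n E k =
     replicate n True @ [False] @ replicate k True @ [False] @
     concat (map (\<lambda>i. map (\<lambda>j. {i, j} \<in> E) [0..<n]) [0..<n])"

text \<open>Words that do not encode an instance are not in the language.\<close>

definition MONOPHONIC_POSITION_SET :: language where
  "MONOPHONIC_POSITION_SET =
     {encode_instance n E k | n E k.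
        simple_graph ({..<n}, E) \<and> 1 \<le> k \<and> k \<le> n \<and>
        (\<exists>S. monophonic_position_set ({..<n}, E) S \<and> card S \<ge> k)}"

lemma replicate_True_False_eq:
  "replicate m True @ False # xs = replicate n True @ False # ys \<longleftrightarrow> m = n \<and> xs = ys"
proof (induction m arbitrary: n)
  case 0
  then show ?case by (cases n) auto
next
  case (Suc m)
  then show ?case by (cases n) auto
qed

lemma encode_instance_inject:
  assumes G: "simple_graph ({..<n}, E)" and G': "simple_graph ({..<n'}, E')"
    and eq: "encode_instance n E k = encode_instance n' E' k'"
  shows "n = n' \<and> E = E' \<and> k = k'"
proof -
  let ?row = "\<lambda>E i. map (\<lambda>j. {i, j} \<in> E) [0..<n]"
  have nk: "n = n'" "k = k'"
    and m: "concat (map (?row E) [0..<n]) = concat (map (?row E') [0..<n])"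
    using eq by (auto simp: encode_instance_def replicate_True_False_eq)
  have "map (?row E) [0..<n] = map (?row E') [0..<n]"
    by (rule concat_injective[OF m]) (auto simp: set_zip)
  then have "{i, j} \<in> E \<longleftrightarrow> {i, j} \<in> E'" if "i < n" "j < n" for i j
    using that by auto
  then have "E = E'"
    using G G' nk by (fastforce simp: simple_graph_def)
  with nk show ?thesis by simp
qed

end

theory Submission imports Defs
begin

text \<open>
  Acceptance of a word by a nondeterministic machine is a binary constraint satisfaction problem: the variables
  are the cells of the space-time tableau, the letters record the transition applied in the row together with
  the symbol and the head marker of every tape at that position, and all consistency conditions relate just two
  cells. Solutions are the maximum cliques of the graph of compatible assignments. Joining a graph \<open>H\<close> on
  \<open>m\<close> vertices with a complete graph on \<open>m\<close> vertices turns cliques of size \<open>k\<close> in \<open>H\<close> into monophonic position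
  sets of size \<open>m + k\<close>: a set that large contains a universal vertex \<open>x\<close>, so two nonadjacent members \<open>u, v\<close>
  would give the induced path \<open>u, x, v\<close>.

  Each entry of the adjacency matrix depends only on bounded information about two tableau cells. A machine
  therefore prints the matrix by nested sweeps over static tapes, the heads serving as loop counters.
\<close>

section \<open>A programming language for multi-tape machines\<close>

text \<open>A matrix bit has to be decided by a finite control, although the coordinates of a cell
  are unbounded. Hence the constraints see only marks on the coordinates and coordinate differences
  clipped to -1, 0, 1 or far. One tape content, \<open>ruler\<close>, serves both as time axis and
  as tape axis, so the tableau is a square of side \<open>W\<close>; row \<open>lo\<close> is time 0
  and column 0 is the first input cell. Tapes are infinite in both directions, so the ruler has a
  margin of \<open>Q\<close> cells on either side of the input, with \<open>Q\<close> above the time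
  bound, and no head of a run leaves it. No arithmetic is programmed. The time polynomial is
  replaced by \<open>c * U ^ d\<close> with \<open>U = max 1 (length w)\<close>: \<open>d\<close>
  nested loops over counters of length \<open>U\<close>, with a body unrolled \<open>c\<close>
  times, write exactly that many cells. For the same reason the universal vertices are not a
  separate block: each of the \<open>R = W * W\<close> variables owns \<open>C\<close> assignments
  followed by \<open>C\<close> universal vertices, so that one uniform nest of loops prints
  everything. With \<open>m = R * C\<close> the threshold is
  \<open>R * C + R = R * (C + 1)\<close>.\<close>

datatype com =
    Do "(nat \<Rightarrow> nat) \<Rightarrow> nat \<Rightarrow> nat \<times> move"
  | Seq com com (infixr ";;" 60)
  | While "(nat \<Rightarrow> nat) \<Rightarrow> bool" com

type_synonym store = "nat \<Rightarrow> tape"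

definition reads :: "nat \<Rightarrow> store \<Rightarrow> nat \<Rightarrow> nat" where
  "reads K \<sigma> j = (if j < K then read_tape (\<sigma> j) else 0)"

definition perform :: "nat \<Rightarrow> (nat \<Rightarrow> nat \<times> move) \<Rightarrow> store \<Rightarrow> store" where
  "perform K a \<sigma> j = (if j < K then act_tape (a j) (\<sigma> j) else \<sigma> j)"

text \<open>The last argument is the exact number of steps of the compiled machine; the
  \<open>2\<close> in the looping case pays for the test and the jump back.\<close>

inductive exec :: "nat \<Rightarrow> com \<Rightarrow> store \<Rightarrow> store \<Rightarrow> nat \<Rightarrow> bool" for K where
  exec_Do: "exec K (Do f) \<sigma> (perform K (f (reads K \<sigma>)) \<sigma>) 1"
| exec_Seq: "exec K c \<sigma> \<sigma>' t \<Longrightarrow> exec K d \<sigma>' \<sigma>'' u \<Longrightarrow> exec K (c ;; d) \<sigma> \<sigma>'' (t + u)"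
| exec_While_False: "\<not> b (reads K \<sigma>) \<Longrightarrow> exec K (While b c) \<sigma> \<sigma> 1"
| exec_While_True: "b (reads K \<sigma>) \<Longrightarrow> exec K c \<sigma> \<sigma>' t \<Longrightarrow> exec K (While b c) \<sigma>' \<sigma>'' u \<Longrightarrow>
    exec K (While b c) \<sigma> \<sigma>'' (t + u + 2)"

type_synonym instr = "(nat \<Rightarrow> nat) \<Rightarrow> nat \<times> (nat \<Rightarrow> nat \<times> move)"

definition keep :: "(nat \<Rightarrow> nat) \<Rightarrow> nat \<Rightarrow> nat \<times> move" where
  "keep r j = (r j, Stay)"

fun len :: "com \<Rightarrow> nat" where
  "len (Do f) = 1"
| "len (c ;; d) = len c + len d"
| "len (While b c) = len c + 2"

text \<open>\<open>q\<close> is the absolute address of the first instruction. A loop has its test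
  at \<open>q\<close>, its body from \<open>Suc q\<close> on and the jump back at
  \<open>q + len c + 1\<close>, so it exits to \<open>q + len c + 2\<close>.\<close>

fun code :: "nat \<Rightarrow> com \<Rightarrow> instr list" where
  "code q (Do f) = [\<lambda>r. (Suc q, f r)]"
| "code q (c ;; d) = code q c @ code (q + len c) d"
| "code q (While b c) =
     (\<lambda>r. (if b r then Suc q else q + len c + 2, keep r)) # code (Suc q) c @ [\<lambda>r. (q, keep r)]"

lemma length_code [simp]: "length (code q c) = len c"
  by (induction c arbitrary: q) auto

definition rd :: "nat \<Rightarrow> nat list \<Rightarrow> nat \<Rightarrow> nat" where
  "rd K as j = (if j < K then as ! j else 0)"

text \<open>States are program counters. The alphabet is cut off at \<open>G\<close> to keep the
  transition set finite, and addresses from \<open>length P\<close> on have no transition, so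
  running off the end halts.\<close>

definition machine :: "nat \<Rightarrow> nat \<Rightarrow> instr list \<Rightarrow> tm" where
  "machine K G P = \<lparr>tape_count = K,
     transitions = (\<lambda>(q, as). (q, as, fst ((P ! q) (rd K as)), map (snd ((P ! q) (rd K as))) [0..<K])) `
       ({..<length P} \<times> {as. set as \<subseteq> {..<G} \<and> length as = K}),
     start_state = 0, accept_state = 0\<rparr>"

lemma tm_wf_machine: "K \<ge> 1 \<Longrightarrow> tm_wf (machine K G P)"
  unfolding tm_wf_def machine_def by (auto simp: finite_lists_length_eq)

lemma deterministic_machine: "deterministic (machine K G P)"
  unfolding deterministic_def machine_def by auto

fun writes_below :: "nat \<Rightarrow> com \<Rightarrow> bool" where
  "writes_below G (Do f) \<longleftrightarrow> (\<forall>r j. (\<forall>j. r j < G) \<longrightarrow> fst (f r j) < G)"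
| "writes_below G (c ;; d) \<longleftrightarrow> writes_below G c \<and> writes_below G d"
| "writes_below G (While b c) \<longleftrightarrow> writes_below G c"

definition bounded :: "nat \<Rightarrow> nat \<Rightarrow> store \<Rightarrow> bool" where
  "bounded K G \<sigma> \<longleftrightarrow> (\<forall>j<K. \<forall>x. fst (\<sigma> j) x < G)"

lemma reads_bounded: "bounded K G \<sigma> \<Longrightarrow> 0 < G \<Longrightarrow> reads K \<sigma> j < G"
  by (cases "\<sigma> j") (auto simp: bounded_def reads_def dest!: spec[of _ j])

lemma act_tape_eq: "act_tape a t = ((fst t)(snd t := fst a), shift_head (snd a) (snd t))"
  by (cases a; cases t) auto

lemma read_tape_eq: "read_tape t = fst t (snd t)"
  by (cases t) auto

lemma bounded_perform:
  "bounded K G \<sigma> \<Longrightarrow> (\<And>j. fst (a j) < G) \<Longrightarrow> bounded K G (perform K a \<sigma>)"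
  by (auto simp: bounded_def perform_def act_tape_eq)

lemma perform_keep [simp]: "perform K (keep (reads K \<sigma>)) \<sigma> = \<sigma>"
  by (auto simp: fun_eq_iff perform_def keep_def reads_def act_tape_eq read_tape_eq)

lemma step_machine:
  assumes "q < length P" "bounded K G \<sigma>" "(P ! q) (reads K \<sigma>) = (q', a)"
  shows "step (machine K G P) (q, map \<sigma> [0..<K]) (q', map (perform K a \<sigma>) [0..<K])"
proof -
  let ?as = "map (\<lambda>j. read_tape (\<sigma> j)) [0..<K]"
  have rd: "rd K ?as = reads K \<sigma>"
    by (auto simp: rd_def reads_def fun_eq_iff)
  have "set ?as \<subseteq> {..<G}"
    using assms(2) by (auto simp: bounded_def read_tape_eq)
  then have "(q, ?as, q', map a [0..<K]) \<in> transitions (machine K G P)"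
    using assms by (auto simp: machine_def rd image_iff intro!: bexI[of _ "(q, ?as)"])
  moreover have "map2 act_tape (map a [0..<K]) (map \<sigma> [0..<K]) = map (perform K a \<sigma>) [0..<K]"
    by (rule nth_equalityI) (auto simp: perform_def)
  ultimately show ?thesis
    unfolding step_def by (auto simp: o_def intro!: exI[of _ q'] exI[of _ "map a [0..<K]"])
qed

text \<open>The context \<open>xs\<close>, \<open>ys\<close> lets the induction place a fragment at
  any address. Boundedness is carried along because the transition table only covers symbols below
  \<open>G\<close>.\<close>

lemma code_correct:
  assumes "exec K c \<sigma> \<sigma>' t" "0 < G" "writes_below G c" "bounded K G \<sigma>"
    "P = xs @ code (length xs) c @ ys"
  shows "(step (machine K G P) ^^ t) (length xs, map \<sigma> [0..<K]) (length xs + len c, map \<sigma>' [0..<K])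
    \<and> bounded K G \<sigma>'"
  using assms
proof (induction arbitrary: xs ys rule: exec.induct)
  case (exec_Do f \<sigma>)
  have "bounded K G (perform K (f (reads K \<sigma>)) \<sigma>)"
    using exec_Do reads_bounded by (intro bounded_perform) auto
  moreover have "step (machine K G P) (length xs, map \<sigma> [0..<K])
     (Suc (length xs), map (perform K (f (reads K \<sigma>)) \<sigma>) [0..<K])"
    using exec_Do by (intro step_machine) auto
  ultimately show ?case by (auto simp: OO_def)
next
  case (exec_Seq c \<sigma> \<sigma>' t d \<sigma>'' u)
  let ?M = "machine K G P"
  have 1: "(step ?M ^^ t) (length xs, map \<sigma> [0..<K]) (length xs + len c, map \<sigma>' [0..<K])
     \<and> bounded K G \<sigma>'"
    using exec_Seq.prems by (intro exec_Seq.IH) auto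
  have "(step ?M ^^ u) (length (xs @ code (length xs) c), map \<sigma>' [0..<K])
     (length (xs @ code (length xs) c) + len d, map \<sigma>'' [0..<K]) \<and> bounded K G \<sigma>''"
    using exec_Seq.prems 1 by (intro exec_Seq.IH) auto
  with 1 show ?case
    by (auto simp: relpowp_add OO_def add.assoc)
next
  case (exec_While_False b \<sigma> c)
  have "step (machine K G P) (length xs, map \<sigma> [0..<K])
     (length xs + len c + 2, map (perform K (keep (reads K \<sigma>)) \<sigma>) [0..<K])"
    using exec_While_False by (intro step_machine) (auto simp: nth_append)
  with exec_While_False show ?case by (auto simp: OO_def)
next
  case (exec_While_True b \<sigma> c \<sigma>' t \<sigma>'' u)
  let ?M = "machine K G P" and ?n = "length xs"
  define I where "I = (\<lambda>r. (if b r then Suc ?n else ?n + len c + 2, keep r))"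
  define J where "J = (\<lambda>r. (?n, keep r))"
  have P: "P = xs @ I # code (Suc ?n) c @ [J] @ ys"
    using exec_While_True.prems by (auto simp: I_def J_def)
  have 1: "step ?M (?n, map \<sigma> [0..<K]) (Suc ?n, map (perform K (keep (reads K \<sigma>)) \<sigma>) [0..<K])"
    using exec_While_True by (intro step_machine) (auto simp: nth_append P I_def)
  have 2: "(step ?M ^^ t) (length (xs @ [I]), map \<sigma> [0..<K])
     (length (xs @ [I]) + len c, map \<sigma>' [0..<K]) \<and> bounded K G \<sigma>'"
    using exec_While_True.prems by (intro exec_While_True.IH(1)[where ys = "[J] @ ys"]) (auto simp: P)
  have "P ! (Suc (?n + len c)) = J"
    by (auto simp: P nth_append)
  then have 3: "step ?M (Suc (?n + len c), map \<sigma>' [0..<K])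
     (?n, map (perform K (keep (reads K \<sigma>')) \<sigma>') [0..<K])"
    using 2 by (intro step_machine) (auto simp: P J_def)
  have 4: "(step ?M ^^ u) (?n, map \<sigma>' [0..<K]) (?n + len (While b c), map \<sigma>'' [0..<K])
     \<and> bounded K G \<sigma>''"
    using exec_While_True.prems 2 by (intro exec_While_True.IH(2)) auto
  have "(step ?M ^^ (1 + (t + (1 + u)))) (?n, map \<sigma> [0..<K]) (?n + len (While b c), map \<sigma>'' [0..<K])"
    unfolding relpowp_add using 1 2 3 4 by (auto simp: OO_def simp del: relpowp.simps(2)) (metis)
  with 4 show ?case by (simp add: algebra_simps)
qed

definition start_store :: "bool list \<Rightarrow> store" where
  "start_store w = (\<lambda>_. (word_tape [], 0))(0 := (word_tape w, 0))"

definition runs :: "nat \<Rightarrow> com \<Rightarrow> store \<Rightarrow> store \<Rightarrow> nat \<Rightarrow> bool" where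
  "runs K c \<sigma> \<sigma>' T \<longleftrightarrow> (\<exists>t\<le>T. exec K c \<sigma> \<sigma>' t)"

lemma polytime_computableI:
  fixes p :: "nat poly"
  assumes "K \<ge> 2" "G \<ge> 3" "writes_below G c"
    and runs: "\<And>w. \<exists>\<sigma>. runs K c (start_store w) \<sigma> (poly p (length w)) \<and> fst (\<sigma> 1) = word_tape (f w)"
  shows "polytime_computable f"
proof -
  define P where "P = code 0 c"
  let ?M = "machine K G P"
  have "computes_in_time ?M f (poly p)"
    unfolding computes_in_time_def
  proof
    fix w
    obtain \<sigma> t where t: "exec K c (start_store w) \<sigma> t" "t \<le> poly p (length w)"
      and \<sigma>: "fst (\<sigma> 1) = word_tape (f w)"
      using runs[of w] by (auto simp: runs_def)
    have "bounded K G (start_store w)"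
      using assms by (auto simp: bounded_def start_store_def word_tape_def)
    then have "(step ?M ^^ t) (0, map (start_store w) [0..<K]) (len c, map \<sigma> [0..<K])"
      using code_correct[OF t(1), of G P "[]" "[]"] assms by (auto simp: P_def)
    moreover have "init_config ?M w = (0, map (start_store w) [0..<K])"
      using assms unfolding init_config_def machine_def
      by (auto intro!: nth_equalityI simp: start_store_def nth_Cons' )
    moreover have "halted ?M (len c, map \<sigma> [0..<K])"
      by (auto simp: halted_def step_def machine_def P_def)
    ultimately show "\<exists>m c. m \<le> poly p (length w) \<and> (step ?M ^^ m) (init_config ?M w) c \<and>
        halted ?M c \<and> fst (snd c ! 1) = word_tape (f w)"
      using t \<sigma> assms by (intro exI[of _ t] exI[of _ "(len c, map \<sigma> [0..<K])"]) auto
  qed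
  then show ?thesis
    unfolding polytime_computable_def
    using assms tm_wf_machine[of K G P] deterministic_machine[of K G P]
    by (intro exI[of _ ?M] exI[of _ p]) (auto simp: machine_def)
qed

section \<open>Timed rules for sequences, unrolled code and counted loops\<close>

lemma runs_mono: "runs K c \<sigma> \<sigma>' T \<Longrightarrow> T \<le> T' \<Longrightarrow> runs K c \<sigma> \<sigma>' T'"
  by (auto simp: runs_def intro: le_trans)

lemma runs_Seq: "runs K c \<sigma> \<sigma>' T \<Longrightarrow> runs K d \<sigma>' \<sigma>'' U \<Longrightarrow> runs K (c ;; d) \<sigma> \<sigma>'' (T + U)"
  unfolding runs_def by (meson add_mono exec_Seq)

lemma runs_While:
  assumes "\<And>k. k < m \<Longrightarrow> b (reads K (\<tau> k)) \<and> runs K c (\<tau> k) (\<tau> (Suc k)) T"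
    and "\<not> b (reads K (\<tau> m))"
  shows "runs K (While b c) (\<tau> 0) (\<tau> m) (m * (T + 2) + 1)"
  using assms
proof (induction m arbitrary: \<tau>)
  case 0
  then show ?case
    using exec_While_False[of b K "\<tau> 0" c] by (auto simp: runs_def)
next
  case (Suc m)
  have "runs K (While b c) (\<tau> (Suc 0)) (\<tau> (Suc m)) (m * (T + 2) + 1)"
    using Suc.prems by (intro Suc.IH[of "\<lambda>k. \<tau> (Suc k)"]) auto
  then obtain u where u: "exec K (While b c) (\<tau> (Suc 0)) (\<tau> (Suc m)) u" "u \<le> m * (T + 2) + 1"
    by (auto simp: runs_def)
  obtain t where t: "exec K c (\<tau> 0) (\<tau> (Suc 0)) t" "t \<le> T"
    using Suc.prems(1)[of 0] by (auto simp: runs_def)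
  have "exec K (While b c) (\<tau> 0) (\<tau> (Suc m)) (t + u + 2)"
    using Suc.prems(1)[of 0] t u by (intro exec_While_True) auto
  then show ?case
    using t u by (auto simp: runs_def algebra_simps intro!: exI[of _ "t + u + 2"])
qed

definition on_tapes :: "nat set \<Rightarrow> (tape \<Rightarrow> tape) \<Rightarrow> store \<Rightarrow> store" where
  "on_tapes Z e \<sigma> j = (if j \<in> Z then e (\<sigma> j) else \<sigma> j)"

text \<open>The tapes outside \<open>Z\<close> are static: they may steer the program but end as they began. This lets
  nested loops be verified independently of what has been written so far.\<close>

definition does :: "nat \<Rightarrow> com \<Rightarrow> store \<Rightarrow> nat set \<Rightarrow> (tape \<Rightarrow> tape) \<Rightarrow> nat \<Rightarrow> bool" where
  "does K c \<sigma> Z e T \<longleftrightarrow>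
     (\<forall>\<tau>. (\<forall>j. j \<notin> Z \<longrightarrow> \<tau> j = \<sigma> j) \<longrightarrow> runs K c \<tau> (on_tapes Z e \<tau>) T)"

lemma on_tapes_comp: "on_tapes Z e' (on_tapes Z e \<sigma>) = on_tapes Z (e' \<circ> e) \<sigma>"
  by (auto simp: on_tapes_def)

text \<open>Both premises may speak of the same \<open>\<sigma>\<close>, since the first program
  leaves everything outside \<open>Z\<close> as it was.\<close>

lemma does_Seq:
  assumes "does K c \<sigma> Z e T" "does K d \<sigma> Z e' U"
  shows "does K (c ;; d) \<sigma> Z (e' \<circ> e) (T + U)"
  unfolding does_def
proof (intro allI impI)
  fix \<tau> assume \<tau>: "\<forall>j. j \<notin> Z \<longrightarrow> \<tau> j = \<sigma> j"
  then have "runs K c \<tau> (on_tapes Z e \<tau>) T"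
    using assms(1) by (auto simp: does_def)
  moreover have "runs K d (on_tapes Z e \<tau>) (on_tapes Z e' (on_tapes Z e \<tau>)) U"
    using assms(2) \<tau> by (auto simp: does_def on_tapes_def)
  ultimately show "runs K (c ;; d) \<tau> (on_tapes Z (e' \<circ> e) \<tau>) (T + U)"
    by (auto simp: on_tapes_comp intro: runs_Seq)
qed

definition skip :: com where "skip = Do keep"

lemma runs_skip: "runs K skip \<sigma> \<sigma> 1"
  using exec_Do[of K keep \<sigma>] by (auto simp: skip_def runs_def)

text \<open>A loop carried out at compile time: the body may depend on its index, which lives in the
  finite control. It serves for bounds that depend on the machine only, such as the number of
  letters.\<close>

fun unroll :: "nat \<Rightarrow> (nat \<Rightarrow> com) \<Rightarrow> com" where
  "unroll 0 c = skip"
| "unroll (Suc n) c = unroll n c ;; c n"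

lemma does_unroll:
  assumes "\<And>k. k < n \<Longrightarrow> does K (c k) \<sigma> Z (e k) T"
  shows "does K (unroll n c) \<sigma> Z (fold e [0..<n]) (n * T + 1)"
  using assms
proof (induction n)
  case 0
  have "on_tapes Z id \<tau> = \<tau>" for \<tau> by (auto simp: on_tapes_def)
  then show ?case
    using runs_skip[of K] by (auto simp: does_def id_def)
next
  case (Suc n)
  have "does K (unroll n c ;; c n) \<sigma> Z (e n \<circ> fold e [0..<n]) (n * T + 1 + T)"
    using Suc by (intro does_Seq) auto
  then show ?case by (simp add: algebra_simps o_def)
qed

fun disp :: "move \<Rightarrow> int" where
  "disp Left = -1" | "disp Stay = 0" | "disp Right = 1"

fun opposite :: "move \<Rightarrow> move" where
  "opposite Left = Right" | "opposite Stay = Stay" | "opposite Right = Left"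

lemma shift_head_disp: "shift_head m h = h + disp m"
  by (cases m) auto

lemma disp_opposite [simp]: "disp (opposite m) = - disp m"
  by (cases m) auto

definition go :: "nat \<Rightarrow> move \<Rightarrow> nat \<Rightarrow> move \<Rightarrow> com" where
  "go x m y s = Do (\<lambda>r j. (r j, if j = x then m else if j = y then s else Stay))"

definition slide :: "nat \<Rightarrow> nat \<Rightarrow> move \<Rightarrow> int \<Rightarrow> store \<Rightarrow> store" where
  "slide x y s k \<sigma> j = (if j = x then (fst (\<sigma> x), snd (\<sigma> x) + k)
     else if j = y then (fst (\<sigma> y), snd (\<sigma> y) + k * disp s) else \<sigma> j)"

lemma runs_go:
  assumes "x < K" "y < K" "x \<noteq> y"
  shows "runs K (go x Right y s) \<sigma> (slide x y s 1 \<sigma>) 1"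
    and "runs K (go x Left y (opposite s)) \<sigma> (slide x y s (- 1) \<sigma>) 1"
proof -
  have "runs K (go x m y s') \<sigma> (slide x y s k \<sigma>) 1"
    if "disp m = k" "disp s' = k * disp s" for m s' k
  proof -
    let ?f = "\<lambda>r j. (r j, if j = x then m else if j = y then s' else Stay)"
    have "perform K (?f (reads K \<sigma>)) \<sigma> = slide x y s k \<sigma>"
      using assms that
      by (auto simp: fun_eq_iff perform_def slide_def act_tape_eq reads_def read_tape_eq shift_head_disp)
    then show ?thesis
      using exec_Do[of K ?f \<sigma>] by (auto simp: runs_def go_def)
  qed
  then show "runs K (go x Right y s) \<sigma> (slide x y s 1 \<sigma>) 1"
    and "runs K (go x Left y (opposite s)) \<sigma> (slide x y s (- 1) \<sigma>) 1" by auto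
qed

lemma slide_slide: "x \<noteq> y \<Longrightarrow> slide x y s a (slide x y s b \<sigma>) = slide x y s (a + b) \<sigma>"
  by (auto simp: fun_eq_iff slide_def algebra_simps)

lemma slide_0 [simp]: "slide x y s 0 \<sigma> = \<sigma>"
  by (auto simp: fun_eq_iff slide_def)

text \<open>The head of tape \<open>x\<close> sweeps over a block of nonblank cells and is rewound afterwards. The head of tape
  \<open>y\<close> moves along with it; two loops that move \<open>y\<close> in opposite directions make its head position the
  difference of their loop counters.\<close>

definition For :: "nat \<Rightarrow> nat \<Rightarrow> move \<Rightarrow> com \<Rightarrow> com" where
  "For x y s c = While (\<lambda>r. r x \<noteq> 0) (c ;; go x Right y s) ;; go x Left y (opposite s) ;;
     While (\<lambda>r. r x \<noteq> 0) (go x Left y (opposite s)) ;; go x Right y s"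

text \<open>The blank behind the block stops the sweep, the blank in front of it stops the
  rewinding.\<close>

definition spans :: "tape \<Rightarrow> nat \<Rightarrow> bool" where
  "spans t m \<longleftrightarrow> (\<forall>k. 0 \<le> k \<and> k < int m \<longrightarrow> fst t (snd t + k) \<noteq> 0) \<and>
     fst t (snd t + int m) = 0 \<and> fst t (snd t - 1) = 0"

lemma does_For:
  assumes K: "x < K" "y < K" "x \<noteq> y" "x \<notin> Z" "y \<notin> Z"
    and spans: "spans (\<sigma> x) m"
    and body: "\<And>k. k < m \<Longrightarrow> does K c (slide x y s (int k) \<sigma>) Z (e k) T"
  shows "does K (For x y s c) \<sigma> Z (fold e [0..<m]) (m * (T + 6) + 6)"
  unfolding does_def
proof (intro allI impI)
  fix \<tau> assume \<tau>: "\<forall>j. j \<notin> Z \<longrightarrow> \<tau> j = \<sigma> j"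
  \<comment> \<open>\<open>k\<close> is the displacement of the head and \<open>n\<close> the number
    of bodies already executed. They grow together in the sweep; during the rewinding only
    \<open>k\<close> changes.\<close>
  define S where "S k n = slide x y s k (on_tapes Z (fold e [0..<n]) \<tau>)" for k n
  note go = runs_go[OF K(1-3)]
  have rx: "reads K (S k n) x = fst (\<sigma> x) (snd (\<sigma> x) + k)" for k n
    using K \<tau> by (auto simp: S_def reads_def slide_def on_tapes_def read_tape_eq)
  have "runs K (While (\<lambda>r. r x \<noteq> 0) (c ;; go x Right y s)) (S (int 0) 0) (S (int m) m) (m * (T + 1 + 2) + 1)"
  proof (rule runs_While[where \<tau> = "\<lambda>k. S (int k) k"])
    fix k assume k: "k < m"
    have "runs K c (S (int k) k) (on_tapes Z (e k) (S (int k) k)) T"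
      using body[OF k] \<tau> K by (auto simp: does_def S_def slide_def on_tapes_def)
    also have "on_tapes Z (e k) (S (int k) k) = S (int k) (Suc k)"
      using K by (auto simp: fun_eq_iff S_def slide_def on_tapes_def)
    finally have "runs K (c ;; go x Right y s) (S (int k) k) (slide x y s 1 (S (int k) (Suc k))) (T + 1)"
      by (rule runs_Seq) (rule go)
    also have "slide x y s 1 (S (int k) (Suc k)) = S (int (Suc k)) (Suc k)"
      using K by (simp add: S_def slide_slide)
    finally show "reads K (S (int k) k) x \<noteq> 0 \<and>
        runs K (c ;; go x Right y s) (S (int k) k) (S (int (Suc k)) (Suc k)) (T + 1)"
      using spans k by (auto simp: rx spans_def)
  qed (use spans in \<open>auto simp: rx spans_def\<close>)
  \<comment> \<open>The head is now on the blank behind the block, which would end the rewinding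
    loop at once, so it first steps back. That loop overshoots to the blank in front, hence the last
    step to the right.\<close>
  moreover have "runs K (go x Left y (opposite s)) (S (int m) m) (S (int m - 1 - int 0) m) 1"
    using go(2)[of s "S (int m) m"] K by (simp add: S_def slide_slide)
  moreover have "runs K (While (\<lambda>r. r x \<noteq> 0) (go x Left y (opposite s)))
      (S (int m - 1 - int 0) m) (S (int m - 1 - int m) m) (m * (1 + 2) + 1)"
  proof (rule runs_While[where \<tau> = "\<lambda>k. S (int m - 1 - int k) m"])
    fix k assume k: "k < m"
    have "runs K (go x Left y (opposite s)) (S (int m - 1 - int k) m) (S (int m - 1 - int (Suc k)) m) 1"
      using go(2)[of s "S (int m - 1 - int k) m"] K by (simp add: S_def slide_slide algebra_simps)
    then show "reads K (S (int m - 1 - int k) m) x \<noteq> 0 \<and>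
        runs K (go x Left y (opposite s)) (S (int m - 1 - int k) m) (S (int m - 1 - int (Suc k)) m) 1"
      using spans k by (auto simp: rx spans_def)
  qed (use spans in \<open>auto simp: rx spans_def\<close>)
  moreover have "runs K (go x Right y s) (S (int m - 1 - int m) m) (S 0 m) 1"
    using go(1)[of s "S (int m - 1 - int m) m"] K by (simp add: S_def slide_slide)
  ultimately have "runs K (For x y s c) (S (int 0) 0) (S 0 m)
      ((m * (T + 1 + 2) + 1) + (1 + ((m * (1 + 2) + 1) + 1)))"
    unfolding For_def by (intro runs_Seq)
  moreover have "S (int 0) 0 = \<tau>"
    by (auto simp: S_def on_tapes_def fun_eq_iff)
  moreover have "S 0 m = on_tapes Z (fold e [0..<m]) \<tau>"
    by (simp add: S_def)
  ultimately show "runs K (For x y s c) \<tau> (on_tapes Z (fold e [0..<m]) \<tau>) (m * (T + 6) + 6)"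
    by (auto elim!: runs_mono simp: algebra_simps)
qed

definition emit1 :: "bool \<Rightarrow> tape \<Rightarrow> tape" where
  "emit1 v = act_tape (if v then 2 else 1, Right)"

definition emits :: "bool list \<Rightarrow> tape \<Rightarrow> tape" where
  "emits = fold emit1"

lemma emits_word_tape: "emits v (word_tape u, int (length u)) = (word_tape (u @ v), int (length (u @ v)))"
proof (induction v arbitrary: u)
  case Nil
  then show ?case by (simp add: emits_def)
next
  case (Cons b v)
  have "emit1 b (word_tape u, int (length u)) = (word_tape (u @ [b]), int (length (u @ [b])))"
    by (auto simp: emit1_def act_tape_eq word_tape_def fun_eq_iff nth_append)
  then show ?case
    using Cons[of "u @ [b]"] by (simp add: emits_def)
qed

lemma fold_emits: "fold (\<lambda>k. emits (u k)) ks = emits (concat (map u ks))"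
  by (induction ks) (auto simp: emits_def)

definition Emit :: "((nat \<Rightarrow> nat) \<Rightarrow> bool) \<Rightarrow> com" where
  "Emit b = Do (\<lambda>r j. if j = 1 then (if b r then 2 else 1, Right) else (r j, Stay))"

text \<open>The test must not look at tape 1, the only tape that is not static here.\<close>

lemma does_Emit:
  assumes "1 < K" and b: "\<And>r r'. (\<And>j. j \<noteq> 1 \<Longrightarrow> r j = r' j) \<Longrightarrow> b r = b r'"
  shows "does K (Emit b) \<sigma> {1} (emits [b (reads K \<sigma>)]) 1"
  unfolding does_def
proof (intro allI impI)
  fix \<tau> assume \<tau>: "\<forall>j. j \<notin> {1} \<longrightarrow> \<tau> j = \<sigma> j"
  have b: "b (reads K \<tau>) = b (reads K \<sigma>)"
    using \<tau> by (intro b) (auto simp: reads_def)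
  let ?f = "\<lambda>r j. if j = 1 then (if b r then 2 else 1, Right) else (r j, Stay)"
  have "perform K (?f (reads K \<tau>)) \<tau> = on_tapes {1} (emits [b (reads K \<sigma>)]) \<tau>"
    using assms(1)
    by (auto simp: fun_eq_iff perform_def on_tapes_def emits_def emit1_def b act_tape_eq reads_def read_tape_eq)
  then show "runs K (Emit b) \<tau> (on_tapes {1} (emits [b (reads K \<sigma>)]) \<tau>) 1"
    using exec_Do[of K ?f \<tau>] by (auto simp: runs_def Emit_def)
qed

section \<open>From binary constraints to monophonic position sets\<close>

text \<open>Nested printing loops become one running index, from which the loop counters are
  recovered as quotient and remainder.\<close>

lemma concat_map_nested:
  "concat (map (\<lambda>x. map (h x) [0..<n]) [0..<m]) = map (\<lambda>v. h (v div n) (v mod n)) [0..<m * n]"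
proof (induction m)
  case (Suc m)
  have "map (h m) [0..<n] = map (\<lambda>v. h (v div n) (v mod n)) [m * n..<m * n + n]"
    by (rule nth_equalityI) auto
  moreover have "[0..<Suc m * n] = [0..<m * n] @ [m * n..<m * n + n]"
    using upt_add_eq_append[of 0 "m * n" n] by (simp add: add.commute)
  ultimately show ?case using Suc by simp
qed auto

lemma concat_concat_map:
  "concat (map (\<lambda>x. concat (map (h x) [0..<n])) [0..<m]) =
   concat (map (\<lambda>v. h (v div n) (v mod n)) [0..<m * n])"
proof -
  have "concat (map (\<lambda>x. concat (map (h x) [0..<n])) [0..<m]) =
     concat (concat (map (\<lambda>x. map (h x) [0..<n]) [0..<m]))"
    by (induction m) auto
  then show ?thesis by (simp only: concat_map_nested)
qed

text \<open>Vertex \<open>s * (2 * C) + a\<close> with \<open>a < C\<close> stands for assigning letter \<open>a\<close> to variable \<open>s\<close>; with \<open>a \<ge> C\<close> it is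
  universal.\<close>

definition csp_adj :: "nat \<Rightarrow> (nat \<Rightarrow> nat \<Rightarrow> nat \<Rightarrow> nat \<Rightarrow> bool) \<Rightarrow> nat \<Rightarrow> nat \<Rightarrow> bool" where
  "csp_adj C cp u v \<longleftrightarrow> u \<noteq> v \<and>
     (C \<le> u mod (2 * C) \<or> C \<le> v mod (2 * C) \<or>
      u div (2 * C) \<noteq> v div (2 * C) \<and>
        cp (u div (2 * C)) (u mod (2 * C)) (v div (2 * C)) (v mod (2 * C)))"

definition csp_edges :: "nat \<Rightarrow> nat \<Rightarrow> (nat \<Rightarrow> nat \<Rightarrow> nat \<Rightarrow> nat \<Rightarrow> bool) \<Rightarrow> nat set set" where
  "csp_edges R C cp = {{u, v} | u v. u < R * (2 * C) \<and> v < R * (2 * C) \<and> csp_adj C cp u v}"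

lemma csp_edges_iff:
  assumes "\<And>s a s' a'. cp s a s' a' \<Longrightarrow> cp s' a' s a" "u < R * (2 * C)" "v < R * (2 * C)"
  shows "{u, v} \<in> csp_edges R C cp \<longleftrightarrow> csp_adj C cp u v"
proof -
  have "csp_adj C cp u v \<longleftrightarrow> csp_adj C cp v u" for u v
    using assms(1) by (auto simp: csp_adj_def)
  then show ?thesis
    using assms(2,3) by (auto simp: csp_edges_def doubleton_eq_iff)
qed

text \<open>Adjacent vertices on an induced path are consecutive, and three positions cannot be
  pairwise consecutive.\<close>

lemma clique_monophonic_position_set:
  assumes "S \<subseteq> V" and clique: "\<And>u v. u \<in> S \<Longrightarrow> v \<in> S \<Longrightarrow> u \<noteq> v \<Longrightarrow> {u, v} \<in> E"
  shows "monophonic_position_set (V, E) S"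
proof -
  have False if S: "u \<in> S" "v \<in> S" "w \<in> S" "u \<noteq> v" "v \<noteq> w" "u \<noteq> w"
    and p: "monophonic_path (V, E) p" "{u, v, w} \<subseteq> set p" for u v w p
  proof -
    have close: "j = Suc i" if "i < j" "j < length p" "p ! i \<in> S" "p ! j \<in> S" for i j
    proof -
      have "p ! i \<noteq> p ! j"
        using that p(1) by (auto simp: monophonic_path_def is_path_def nth_eq_iff_index_eq)
      then show ?thesis
        using that p(1) clique by (auto simp: monophonic_path_def)
    qed
    obtain a b c where abc: "a < length p" "p ! a = u" "b < length p" "p ! b = v"
      "c < length p" "p ! c = w"
      using p(2) by (auto simp: in_set_conv_nth)
    then have "a \<noteq> b" "b \<noteq> c" "a \<noteq> c"
      using S by auto
    moreover have "j = Suc i \<or> i = Suc j \<or> i = j"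
      if "i \<in> {a, b, c}" "j \<in> {a, b, c}" for i j
    proof -
      have "i < length p" "j < length p" "p ! i \<in> S" "p ! j \<in> S"
        using that abc S by auto
      then show ?thesis
        using close[of i j] close[of j i] by (meson nat_neq_iff)
    qed
    then have "b = Suc a \<or> a = Suc b \<or> a = b" "c = Suc b \<or> b = Suc c \<or> b = c"
      "c = Suc a \<or> a = Suc c \<or> a = c" by auto
    ultimately show False by linarith
  qed
  then show ?thesis
    using assms(1) unfolding monophonic_position_set_def by auto
qed

lemma monophonic_position_set_dominated:
  assumes S: "monophonic_position_set (V, E) S" and uxv: "u \<in> S" "x \<in> S" "v \<in> S" "u \<noteq> v" "x \<noteq> u" "x \<noteq> v"
    and E: "{u, x} \<in> E" "{x, v} \<in> E"
  shows "{u, v} \<in> E"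
proof (rule ccontr)
  assume nE: "{u, v} \<notin> E"
  have "monophonic_path (V, E) [u, x, v]"
    using S uxv E nE
    by (auto simp: monophonic_path_def is_path_def monophonic_position_set_def less_Suc_eq nth_Cons'
        numeral_eq_Suc)
  then show False
    using S uxv unfolding monophonic_position_set_def by (metis empty_subsetI insert_subset list.set_intros(1,2))
qed

lemma mult_add_div_mod:
  assumes "a < (n :: nat)"
  shows "(s * n + a) div n = s" "(s * n + a) mod n = a"
  using assms by auto

lemma mult_add_less:
  assumes "a < (n :: nat)" "s < R"
  shows "s * n + a < R * n"
proof -
  have "s * n + a < (s + 1) * n" using assms by simp
  also have "\<dots> \<le> R * n" using assms by (intro mult_right_mono) auto
  finally show ?thesis .
qed

lemma card_mod_slice:
  assumes "A \<subseteq> {..<n}"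
  shows "card {v. v < R * n \<and> v mod n \<in> A} = R * card A"
proof -
  have "bij_betw (\<lambda>v. (v div n, v mod n)) {v. v < R * n \<and> v mod n \<in> A} ({..<R} \<times> A)"
  proof (rule bij_betw_byWitness[where f' = "\<lambda>(s, a). s * n + a"])
    show "(\<lambda>v. (v div n, v mod n)) ` {v. v < R * n \<and> v mod n \<in> A} \<subseteq> {..<R} \<times> A"
      by (auto simp: less_mult_imp_div_less)
    show "(\<lambda>(s, a). s * n + a) ` ({..<R} \<times> A) \<subseteq> {v. v < R * n \<and> v mod n \<in> A}"
    proof safe
      fix s a assume sa: "s < R" "a \<in> A"
      then have a: "a < n" using assms by auto
      show "s * n + a < R * n" using mult_add_less[OF a sa(1)] .
      show "(s * n + a) mod n \<in> A" using a sa by simp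
    qed
    show "\<forall>y\<in>{..<R} \<times> A. (\<lambda>v. (v div n, v mod n)) ((\<lambda>(s, a). s * n + a) y) = y"
      using assms by auto
  qed auto
  from bij_betw_same_card[OF this] show ?thesis by (simp add: card_cartesian_product)
qed

text \<open>The threshold counts all \<open>R * C\<close> universal vertices and one assignment for
  each of the \<open>R\<close> variables.\<close>

lemma csp_mono_iff:
  assumes R: "0 < R" and sym: "\<And>s a s' a'. cp s a s' a' \<Longrightarrow> cp s' a' s a"
  shows "(\<exists>S. monophonic_position_set ({..<R * (2 * C)}, csp_edges R C cp) S \<and> R * (C + 1) \<le> card S) \<longleftrightarrow>
    (\<exists>x. (\<forall>s<R. x s < C) \<and> (\<forall>s<R. \<forall>s'<R. s \<noteq> s' \<longrightarrow> cp s (x s) s' (x s')))"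
    (is "?lhs \<longleftrightarrow> ?rhs")
proof -
  let ?N = "R * (2 * C)" and ?E = "csp_edges R C cp"
  have edge: "{u, v} \<in> ?E \<longleftrightarrow> csp_adj C cp u v" if "u < ?N" "v < ?N" for u v
    by (rule csp_edges_iff[of cp u R C v, OF sym that])
  define U where "U = {v. v < ?N \<and> v mod (2 * C) \<in> {C..<2 * C}}"
  define D where "D = {v. v < ?N \<and> v mod (2 * C) \<in> {..<C}}"
  have cardU: "card U = R * C" and cardD: "card D = R * C"
    unfolding U_def D_def by (subst card_mod_slice; auto)+
  have UD: "{..<?N} = U \<union> D"
  proof -
    have "0 < C" if "v < ?N" for v using that by (cases C) auto
    then show ?thesis by (auto simp: U_def D_def not_less)
  qed
  have fin: "finite U" "finite D" by (auto simp: U_def D_def)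
  show ?thesis
  proof
    assume ?lhs
    then obtain S where S: "monophonic_position_set ({..<?N}, ?E) S" "R * (C + 1) \<le> card S" by blast
    have SN: "S \<subseteq> {..<?N}" using S by (auto simp: monophonic_position_set_def)
    then have finS: "finite S" by (rule finite_subset) auto
    have split: "S = (S \<inter> U) \<union> (S \<inter> D)" using SN UD by auto
    have "card S \<le> card (S \<inter> U) + card (S \<inter> D)"
      by (subst split) (rule card_Un_le)
    moreover have "card (S \<inter> U) \<le> R * C" "card (S \<inter> D) \<le> R * C"
      using cardU cardD fin by (metis card_mono inf_le2)+
    \<comment> \<open>Each of the two halves holds at most \<open>R * C\<close> members of
      \<open>S\<close>, fewer than \<open>R * (C + 1)\<close>. So a universal vertex occurs, and at
      least \<open>R\<close> assignments do.\<close>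
    ultimately have P: "R \<le> card (S \<inter> D)" and "S \<inter> U \<noteq> {}"
      using S(2) R by (auto simp: algebra_simps)
    then obtain x where x: "x \<in> S" "x \<in> U" by auto
    have clique: "csp_adj C cp u v" if "u \<in> S \<inter> D" "v \<in> S \<inter> D" "u \<noteq> v" for u v
    proof -
      have "x \<noteq> u" "x \<noteq> v" using that x by (auto simp: U_def D_def)
      moreover have "u < ?N" "x < ?N" "v < ?N" using that x SN by auto
      moreover have "C \<le> x mod (2 * C)" using x by (auto simp: U_def)
      ultimately show ?thesis
        using monophonic_position_set_dominated[OF S(1), of u x v] that x
        by (auto simp: edge csp_adj_def)
    qed
    \<comment> \<open>Two letters for the same variable are never adjacent, so the clique has at
      most one member per variable; with at least \<open>R\<close> members it meets every
      variable.\<close>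
    have inj: "inj_on (\<lambda>v. v div (2 * C)) (S \<inter> D)"
      using clique by (force simp: inj_on_def csp_adj_def D_def)
    have sub: "(\<lambda>v. v div (2 * C)) ` (S \<inter> D) \<subseteq> {..<R}"
      by (auto simp: D_def less_mult_imp_div_less)
    then have surj: "(\<lambda>v. v div (2 * C)) ` (S \<inter> D) = {..<R}"
      using P card_image[OF inj] by (intro card_seteq) simp_all
    have "\<forall>s<R. \<exists>v. v \<in> S \<inter> D \<and> v div (2 * C) = s"
    proof (intro allI impI)
      fix s assume "s < R"
      then have "s \<in> (\<lambda>v. v div (2 * C)) ` (S \<inter> D)" by (simp only: surj lessThan_iff)
      then show "\<exists>v. v \<in> S \<inter> D \<and> v div (2 * C) = s" by blast
    qed
    then obtain y where y: "\<And>s. s < R \<Longrightarrow> y s \<in> S \<inter> D \<and> y s div (2 * C) = s" by metis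
    have "cp s (y s mod (2 * C)) s' (y s' mod (2 * C))" if "s < R" "s' < R" "s \<noteq> s'" for s s'
    proof -
      have "y s \<noteq> y s'" using y that by metis
      then have "csp_adj C cp (y s) (y s')" using clique y that by auto
      then show ?thesis
        using y[OF that(1)] y[OF that(2)] by (auto simp: csp_adj_def D_def)
    qed
    then show ?rhs
      using y by (intro exI[of _ "\<lambda>s. y s mod (2 * C)"]) (auto simp: D_def)
  next
    assume ?rhs
    then obtain x where "\<forall>s<R. x s < C" "\<forall>s<R. \<forall>s'<R. s \<noteq> s' \<longrightarrow> cp s (x s) s' (x s')"
      by (elim exE conjE)
    then have x: "\<And>s. s < R \<Longrightarrow> x s < C"
      "\<And>s s'. s < R \<Longrightarrow> s' < R \<Longrightarrow> s \<noteq> s' \<Longrightarrow> cp s (x s) s' (x s')" by simp_all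
    \<comment> \<open>Conversely, the assignments of a solution together with all universal vertices
      form a clique.\<close>
    define P where "P = (\<lambda>s. s * (2 * C) + x s) ` {..<R}"
    have PD: "P \<subseteq> D"
    proof
      fix v assume "v \<in> P"
      then obtain s where s: "s < R" "v = s * (2 * C) + x s" by (auto simp: P_def)
      have "x s < C" using x(1) s(1) by blast
      then have "x s < 2 * C" by simp
      from mult_add_less[OF this s(1)] mult_add_div_mod(2)[OF this, of s] \<open>x s < C\<close>
      show "v \<in> D" unfolding D_def s(2) by simp
    qed
    have "inj_on (\<lambda>s. s * (2 * C) + x s) {..<R}"
    proof (rule inj_onI)
      fix s s' assume s: "s \<in> {..<R}" "s' \<in> {..<R}" and eq: "s * (2 * C) + x s = s' * (2 * C) + x s'"
      have "x s < 2 * C" "x s' < 2 * C"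
        using s x(1)[of s] x(1)[of s'] by simp_all
      then show "s = s'" using eq mult_add_div_mod(1) by metis
    qed
    then have "card P = R" by (simp add: P_def card_image)
    moreover have "P \<inter> U = {}" using PD by (auto simp: D_def U_def)
    ultimately have "card (P \<union> U) = R * (C + 1)"
      using PD fin cardU by (subst card_Un_disjoint) (auto intro: finite_subset)
    moreover have "monophonic_position_set ({..<?N}, ?E) (P \<union> U)"
    proof (rule clique_monophonic_position_set)
      show sub: "P \<union> U \<subseteq> {..<?N}" using PD UD by auto
      fix u v assume uv: "u \<in> P \<union> U" "v \<in> P \<union> U" "u \<noteq> v"
      have "csp_adj C cp u v"
      proof (cases "u \<in> P \<and> v \<in> P")
        case True
        then obtain s s' where s: "s < R" "u = s * (2 * C) + x s" "s' < R" "v = s' * (2 * C) + x s'"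
          by (auto simp: P_def)
        then have "x s < 2 * C" "x s' < 2 * C" "s \<noteq> s'"
          using uv(3) x(1)[of s] x(1)[of s'] by auto
        then show ?thesis
          using uv(3) x(2)[OF s(1,3)] unfolding csp_adj_def s(2,4) by (simp only: mult_add_div_mod) simp
      next
        case False
        then show ?thesis using uv by (auto simp: U_def csp_adj_def)
      qed
      then show "{u, v} \<in> ?E" using uv sub by (subst edge) auto
    qed
    ultimately show ?lhs by (intro exI[of _ "P \<union> U"]) auto
  qed
qed

text \<open>Injectivity of the encoding reduces membership to this one instance. The bound
  \<open>k \<le> n\<close> follows from a witness, since a set of that size needs that many
  vertices; this also settles \<open>C = 0\<close>, where both sides fail.\<close>

lemma csp_instance_iff:
  assumes R: "0 < R" and sym: "\<And>s a s' a'. cp s a s' a' \<Longrightarrow> cp s' a' s a"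
  shows "encode_instance (R * (2 * C)) (csp_edges R C cp) (R * (C + 1)) \<in> MONOPHONIC_POSITION_SET \<longleftrightarrow>
    (\<exists>x. (\<forall>s<R. x s < C) \<and> (\<forall>s<R. \<forall>s'<R. s \<noteq> s' \<longrightarrow> cp s (x s) s' (x s')))"
proof -
  let ?N = "R * (2 * C)" and ?E = "csp_edges R C cp" and ?k = "R * (C + 1)"
  have simple: "simple_graph ({..<?N}, ?E)"
    by (fastforce simp: simple_graph_def csp_edges_def csp_adj_def)
  have "encode_instance ?N ?E ?k \<in> MONOPHONIC_POSITION_SET \<longleftrightarrow>
     1 \<le> ?k \<and> ?k \<le> ?N \<and> (\<exists>S. monophonic_position_set ({..<?N}, ?E) S \<and> ?k \<le> card S)"
    using encode_instance_inject[OF simple] simple unfolding MONOPHONIC_POSITION_SET_def by blast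
  also have "\<dots> \<longleftrightarrow> (\<exists>S. monophonic_position_set ({..<?N}, ?E) S \<and> ?k \<le> card S)"
  proof -
    have "card S \<le> ?N" if "monophonic_position_set ({..<?N}, ?E) S" for S
      using that card_mono[of "{..<?N}" S] by (auto simp: monophonic_position_set_def)
    moreover have "1 \<le> ?k" using R by simp
    ultimately show ?thesis using le_trans[of ?k _ ?N] by blast
  qed
  finally show ?thesis using csp_mono_iff[OF assms] by simp
qed

section \<open>Tableaux of nondeterministic machines\<close>

text \<open>A padded machine stays forever in accepting halted configurations, whereas rejecting ones remain stuck, so
  acceptance means that a run of any given length beyond the time bound exists.\<close>

definition loops :: "tm \<Rightarrow> nat \<Rightarrow> transition set" where
  "loops M G = {(accept_state M, as, accept_state M, map (\<lambda>a. (a, Stay)) as) | as.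
     set as \<subseteq> {..<G} \<and> length as = tape_count M \<and>
     (\<forall>q' acts. (accept_state M, as, q', acts) \<notin> transitions M)}"

definition padded :: "tm \<Rightarrow> nat \<Rightarrow> tm" where
  "padded M G = M\<lparr>transitions := transitions M \<union> loops M G\<rparr>"

definition symbols_below :: "tm \<Rightarrow> nat \<Rightarrow> bool" where
  "symbols_below M G \<longleftrightarrow> 3 \<le> G \<and> (\<forall>(q, as, q', acts) \<in> transitions M. \<forall>x \<in> set acts. fst x < G)"

definition config_bounded :: "tm \<Rightarrow> nat \<Rightarrow> nat \<Rightarrow> config \<Rightarrow> bool" where
  "config_bounded M G h c \<longleftrightarrow> length (snd c) = tape_count M \<and>
     (\<forall>j<tape_count M. (\<forall>x. fst (snd c ! j) x < G) \<and> \<bar>snd (snd c ! j)\<bar> \<le> int h)"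

lemma ex_symbols_below:
  assumes "tm_wf M"
  shows "\<exists>G. symbols_below M G"
proof -
  let ?S = "\<Union>(q, as, q', acts) \<in> transitions M. fst ` set acts"
  have "finite ?S" using assms by (auto simp: tm_wf_def)
  then obtain k where k: "\<forall>x\<in>?S. x < k" unfolding finite_nat_set_iff_bounded by blast
  have "symbols_below M (k + 3)"
    unfolding symbols_below_def
  proof (intro conjI ballI, goal_cases)
    case (2 x)
    obtain q as q' acts where x: "x = (q, as, q', acts)" by (cases x)
    have "fst y < k" if "y \<in> set acts" for y
      using k that 2 unfolding x by blast
    then show ?case unfolding x by (auto intro: trans_less_add1)
  qed simp
  then show ?thesis ..
qed

lemma disp_bound: "\<bar>disp m\<bar> \<le> 1"
  by (cases m) auto

lemma config_bounded_step:
  assumes "tm_wf M" "symbols_below M G" "step M c c'" "config_bounded M G h c"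
  shows "config_bounded M G (Suc h) c'"
proof -
  obtain q' acts where tr: "(fst c, map read_tape (snd c), q', acts) \<in> transitions M"
    and c': "c' = (q', map2 act_tape acts (snd c))"
    using assms(3) by (auto simp: step_def)
  have len: "length acts = tape_count M" and acts: "\<forall>x\<in>set acts. fst x < G"
    using tr assms(1,2) by (auto simp: tm_wf_def symbols_below_def)
  have "\<bar>snd (snd c ! j) + disp (snd (acts ! j))\<bar> \<le> 1 + int h"
    if "j < tape_count M" for j
    using that assms(4) disp_bound[of "snd (acts ! j)"] unfolding config_bounded_def by fastforce
  then show ?thesis
    using assms(4) len acts
    by (auto simp: config_bounded_def c' act_tape_eq shift_head_disp)
qed

lemma config_bounded_init:
  assumes "tm_wf M" "symbols_below M G"
  shows "config_bounded M G 0 (init_config M w)"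
  using assms by (auto simp: config_bounded_def init_config_def tm_wf_def symbols_below_def
      nth_Cons' word_tape_def)

lemma config_bounded_steps:
  assumes "tm_wf M" "symbols_below M G"
  shows "(step M ^^ m) (init_config M w) c \<Longrightarrow> config_bounded M G m c"
  using config_bounded_step[OF assms] config_bounded_init[OF assms]
  by (induction m arbitrary: c) auto

lemma step_padded_cases:
  assumes "step (padded M G) c c'"
  shows "step M c c' \<or> c' = c \<and> halted M c \<and> fst c = accept_state M"
proof -
  obtain q' acts where tr: "(fst c, map read_tape (snd c), q', acts) \<in> transitions (padded M G)"
    and c': "c' = (q', map2 act_tape acts (snd c))"
    using assms by (auto simp: step_def)
  show ?thesis
  proof (cases "(fst c, map read_tape (snd c), q', acts) \<in> transitions M")
    case True
    then show ?thesis by (auto simp: step_def c')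
  next
    case False
    then have l: "(fst c, map read_tape (snd c), q', acts) \<in> loops M G"
      using tr by (simp add: padded_def)
    then have "map2 act_tape acts (snd c) = snd c"
      by (auto simp: loops_def act_tape_eq read_tape_eq intro!: nth_equalityI)
    then show ?thesis
      using l by (auto simp: c' loops_def halted_def step_def prod_eq_iff)
  qed
qed

text \<open>Once a padding loop is taken, the configuration is halted for \<open>M\<close> and never
  changes again: a padded run is a genuine run followed by idling.\<close>

lemma steps_padded_cases:
  "(step (padded M G) ^^ m) c c' \<Longrightarrow>
     \<exists>m'\<le>m. (step M ^^ m') c c' \<and> (m' = m \<or> halted M c' \<and> fst c' = accept_state M)"
proof (induction m arbitrary: c')
  case (Suc m)
  obtain c1 where c1: "(step (padded M G) ^^ m) c c1" and st: "step (padded M G) c1 c'"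
    using Suc.prems by auto
  from Suc.IH[OF c1] obtain m' where m': "m' \<le> m" "(step M ^^ m') c c1"
    "m' = m \<or> halted M c1 \<and> fst c1 = accept_state M" by blast
  from step_padded_cases[OF st] show ?case
  proof
    assume s: "step M c1 c'"
    then have "m' = m" using m' unfolding halted_def by blast
    then show ?thesis using m' s by (intro exI[of _ "Suc m"]) auto
  next
    assume "c' = c1 \<and> halted M c1 \<and> fst c1 = accept_state M"
    then show ?thesis using m' by (intro exI[of _ m']) auto
  qed
qed auto

lemma step_padded_loop:
  assumes "config_bounded M G h c" "halted M c" "fst c = accept_state M"
  shows "step (padded M G) c c"
proof -
  let ?as = "map read_tape (snd c)" and ?acts = "map (\<lambda>a. (a, Stay)) (map read_tape (snd c))"
  have "\<forall>x\<in>set ?as. x < G"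
    using assms(1) by (fastforce simp: config_bounded_def read_tape_eq in_set_conv_nth)
  moreover have "(accept_state M, ?as, q', acts) \<notin> transitions M" for q' acts
    using assms(2,3) by (auto simp: halted_def step_def)
  ultimately have "(fst c, ?as, fst c, ?acts) \<in> loops M G"
    using assms(1,3) by (auto simp: loops_def config_bounded_def)
  moreover have "map2 act_tape ?acts (snd c) = snd c"
    by (auto simp: act_tape_eq read_tape_eq intro!: nth_equalityI)
  ultimately show ?thesis
    unfolding step_def padded_def by (intro exI[of _ "fst c"] exI[of _ ?acts]) (auto simp: prod_eq_iff)
qed

text \<open>A padded run beyond the time bound must idle, which is possible only in an accepting
  halted configuration. Conversely, an accepting run can idle up to any length.\<close>

lemma accepts_iff_padded_run:
  assumes dec: "decides_in_time M A T" and wf: "tm_wf M" "symbols_below M G"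
    and n: "T (length w) < n"
  shows "w \<in> A \<longleftrightarrow> (\<exists>c. (step (padded M G) ^^ n) (init_config M w) c)"
proof
  assume "w \<in> A"
  then obtain c where c: "(step M)\<^sup>*\<^sup>* (init_config M w) c" "halted M c" "fst c = accept_state M"
    using dec by (auto simp: decides_in_time_def)
  then obtain m where m: "(step M ^^ m) (init_config M w) c"
    using rtranclp_imp_relpowp by metis
  have "step (padded M G) c1 c2" if "step M c1 c2" for c1 c2
    using that by (auto simp: step_def padded_def)
  then have "(step (padded M G) ^^ m) (init_config M w) c"
    using m relpowp_mono[of "step M" "step (padded M G)"] by blast
  moreover have "m \<le> T (length w)" using m dec unfolding decides_in_time_def by blast
  moreover have "(step (padded M G) ^^ k) c c" for k
    using step_padded_loop[OF config_bounded_steps[OF wf m] c(2,3)] by (induction k) auto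
  ultimately have "(step (padded M G) ^^ (m + (n - m))) (init_config M w) c"
    unfolding relpowp_add by blast
  moreover have "m + (n - m) = n" using \<open>m \<le> T (length w)\<close> n by simp
  ultimately show "\<exists>c. (step (padded M G) ^^ n) (init_config M w) c" by metis
next
  assume "\<exists>c. (step (padded M G) ^^ n) (init_config M w) c"
  then obtain c m where m: "(step M ^^ m) (init_config M w) c"
    "m = n \<or> halted M c \<and> fst c = accept_state M"
    using steps_padded_cases by blast
  have "m \<le> T (length w)" using m dec unfolding decides_in_time_def by blast
  then have "halted M c \<and> fst c = accept_state M" using m n by auto
  then show "w \<in> A"
    using dec m(1) relpowp_imp_rtranclp unfolding decides_in_time_def by metis
qed

section \<open>Letters and local constraints of the tableau\<close>

type_synonym letter = "transition \<times> (nat \<times> bool) list"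

fun source :: "transition \<Rightarrow> nat" where "source (q, as, q', acts) = q"
fun scanned :: "transition \<Rightarrow> nat list" where "scanned (q, as, q', acts) = as"
fun target :: "transition \<Rightarrow> nat" where "target (q, as, q', acts) = q'"
fun actions :: "transition \<Rightarrow> (nat \<times> move) list" where "actions (q, as, q', acts) = acts"

definition symbol :: "letter \<Rightarrow> nat \<Rightarrow> nat" where "symbol a j = fst (snd a ! j)"
definition head :: "letter \<Rightarrow> nat \<Rightarrow> bool" where "head a j = snd (snd a ! j)"

text \<open>Applicability of a transition involves the heads of all tapes at once. As every cell of
  a row carries the whole transition, it splits into checks of single head cells against
  \<open>scanned\<close>.\<close>

definition letters :: "tm \<Rightarrow> nat \<Rightarrow> letter set" where
  "letters M G = {a. fst a \<in> transitions (padded M G) \<and> length (snd a) = tape_count M \<and>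
     (\<forall>j<tape_count M. symbol a j < G \<and> (head a j \<longrightarrow> symbol a j = scanned (fst a) ! j))}"

text \<open>Inverts the cell coding of \<open>ruler\<close> below, which marks the first cell by 7 and position 0 by an offset of 4.\<close>

definition decode :: "nat \<Rightarrow> nat" where
  "decode c = (if c = 7 then 0 else if c \<ge> 4 then c - 4 else c - 1)"

text \<open>Mark 7 on the time axis singles out the first row; marks 4 to 6 on the tape axis single
  out cell 0, where all heads start.\<close>

definition initial :: "tm \<Rightarrow> nat \<Rightarrow> nat \<Rightarrow> letter \<Rightarrow> bool" where
  "initial M ct ci a \<longleftrightarrow> (ct = 7 \<longrightarrow> source (fst a) = start_state M \<and>
     (\<forall>j<tape_count M. symbol a j = (if j = 0 then decode ci else 0) \<and> (head a j \<longleftrightarrow> ci \<in> {4, 5, 6})))"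

text \<open>\<open>b\<close> lies one row after \<open>a\<close>, and \<open>e\<close> is the column
  of \<open>b\<close> minus that of \<open>a\<close>. Only the arrival of a head is demanded; that
  no other head appears is left to the clause for equal rows in \<open>compatible\<close>.\<close>

definition succ_row :: "tm \<Rightarrow> int \<Rightarrow> letter \<Rightarrow> letter \<Rightarrow> bool" where
  "succ_row M e a b \<longleftrightarrow> target (fst a) = source (fst b) \<and>
     (e = 0 \<longrightarrow> (\<forall>j<tape_count M. symbol b j = (if head a j then fst (actions (fst a) ! j) else symbol a j))) \<and>
     (\<forall>j<tape_count M. head a j \<and> disp (snd (actions (fst a) ! j)) = e \<longrightarrow> head b j)"

text \<open>Cells \<open>(t, i)\<close> and \<open>(t', i')\<close> of the tableau enter only through \<open>dt = t - t'\<close>, \<open>di = i - i'\<close> and the marks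
  \<open>ct, ci, ct', ci'\<close> that a tape shows at the coordinates.\<close>

definition compatible :: "tm \<Rightarrow> int \<Rightarrow> int \<Rightarrow> nat \<Rightarrow> nat \<Rightarrow> letter \<Rightarrow> nat \<Rightarrow> nat \<Rightarrow> letter \<Rightarrow> bool" where
  "compatible M dt di ct ci a ct' ci' b \<longleftrightarrow> initial M ct ci a \<and> initial M ct' ci' b \<and>
     (dt = 0 \<longrightarrow> fst a = fst b \<and> (\<forall>j<tape_count M. \<not> (head a j \<and> head b j))) \<and>
     (dt = - 1 \<longrightarrow> succ_row M (- di) a b) \<and> (dt = 1 \<longrightarrow> succ_row M di b a)"

lemma compatible_sym: "compatible M dt di ct ci a ct' ci' b \<longleftrightarrow> compatible M (- dt) (- di) ct' ci' b ct ci a"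
  by (auto simp: compatible_def)

definition clip :: "int \<Rightarrow> int" where "clip z = (if \<bar>z\<bar> \<le> 1 then z else 2)"

text \<open>Differences are only compared with 0, 1, -1 and with head displacements, so all values
  of larger modulus act alike and \<open>2\<close> may represent them.\<close>

lemma compatible_clip: "compatible M (clip dt) (clip di) = compatible M dt di"
proof -
  have "clip dt = 0 \<longleftrightarrow> dt = 0" "clip dt = 1 \<longleftrightarrow> dt = 1" "clip dt = - 1 \<longleftrightarrow> dt = - 1" for dt
    by (auto simp: clip_def)
  moreover have "disp m = clip di \<longleftrightarrow> disp m = di" "disp m = - clip di \<longleftrightarrow> disp m = - di" for m
    by (cases m; auto simp: clip_def)+
  ultimately show ?thesis
    by (simp add: fun_eq_iff compatible_def succ_row_def)
qed

text \<open>The alphabet depends on the machine only, so it can be built into the program of the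
  reduction.\<close>

lemma finite_letters:
  assumes "tm_wf M"
  shows "finite (letters M G)"
proof -
  let ?K = "tape_count M"
  have "loops M G \<subseteq> (\<lambda>as. (accept_state M, as, accept_state M, map (\<lambda>a. (a, Stay)) as)) `
      {as. set as \<subseteq> {..<G} \<and> length as = ?K}"
    by (auto simp: loops_def)
  then have "finite (loops M G)"
    by (rule finite_subset) (auto simp: finite_lists_length_eq)
  then have "finite (transitions (padded M G) \<times> {cs. set cs \<subseteq> {..<G} \<times> (UNIV :: bool set) \<and> length cs = ?K})"
    using assms by (intro finite_cartesian_product finite_lists_length_eq) (auto simp: padded_def tm_wf_def)
  moreover have "letters M G \<subseteq> transitions (padded M G) \<times> {cs. set cs \<subseteq> {..<G} \<times> (UNIV :: bool set) \<and> length cs = ?K}"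
    by (fastforce simp: letters_def symbol_def in_set_conv_nth)
  ultimately show ?thesis by (rule rev_finite_subset)
qed

lemma tm_wf_padded:
  assumes "tm_wf M" "tr \<in> transitions (padded M G)"
  shows "length (scanned tr) = tape_count M" "length (actions tr) = tape_count M"
  using assms by (auto simp: padded_def loops_def tm_wf_def)

section \<open>Valid tableaux and runs of the padded machine\<close>

definition valid_tableau :: "tm \<Rightarrow> nat \<Rightarrow> (int \<Rightarrow> nat) \<Rightarrow> int \<Rightarrow> int \<Rightarrow> (int \<Rightarrow> int \<Rightarrow> letter) \<Rightarrow> bool" where
  "valid_tableau M G g lo hi X \<longleftrightarrow>
     (\<forall>t\<in>{lo..<hi}. \<forall>i\<in>{lo..<hi}. X t i \<in> letters M G) \<and>
     (\<forall>t\<in>{lo..<hi}. \<forall>i\<in>{lo..<hi}. \<forall>t'\<in>{lo..<hi}. \<forall>i'\<in>{lo..<hi}. (t, i) \<noteq> (t', i') \<longrightarrow>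
        compatible M (t - t') (i - i') (g t) (g i) (X t i) (g t') (g i') (X t' i'))"

lemma valid_tableau_compatible:
  assumes "valid_tableau M G g lo hi X"
    and "t \<in> {lo..<hi}" "i \<in> {lo..<hi}" "t' \<in> {lo..<hi}" "i' \<in> {lo..<hi}" "(t, i) \<noteq> (t', i')"
  shows "compatible M (t - t') (i - i') (g t) (g i) (X t i) (g t') (g i') (X t' i')"
  using assms unfolding valid_tableau_def by blast

definition coordinates :: "bool list \<Rightarrow> (int \<Rightarrow> nat) \<Rightarrow> int \<Rightarrow> int \<Rightarrow> bool" where
  "coordinates w g lo hi \<longleftrightarrow> (\<forall>i\<in>{lo..<hi}. decode (g i) = word_tape w i \<and>
     (g i \<in> {4, 5, 6} \<longleftrightarrow> i = 0) \<and> (g i = 7 \<longleftrightarrow> i = lo))"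

lemma coordinatesD:
  assumes "coordinates w g lo hi" "lo \<le> i" "i < hi"
  shows "decode (g i) = word_tape w i" "g i \<in> {4, 5, 6} \<longleftrightarrow> i = 0" "g i = 7 \<longleftrightarrow> i = lo"
proof -
  have "i \<in> {lo..<hi}" using assms(2,3) by simp
  with assms(1) show "decode (g i) = word_tape w i" "g i \<in> {4, 5, 6} \<longleftrightarrow> i = 0" "g i = 7 \<longleftrightarrow> i = lo"
    unfolding coordinates_def by blast+
qed

text \<open>Row \<open>lo + int n\<close> describes the configuration after \<open>n\<close> padded
  steps. At most \<open>B\<close> of these are genuine, so all heads stay in the window, where the
  constraints see them.\<close>

lemma valid_tableau_run:
  assumes wf: "tm_wf M" "symbols_below M G"
    and time: "\<forall>m c. (step M ^^ m) (init_config M w) c \<longrightarrow> m \<le> B"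
    and range: "lo < - int B" "int B < hi"
    and coords: "coordinates w g lo hi"
    and X: "valid_tableau M G g lo hi X"
  shows "int n < hi - lo \<Longrightarrow> \<exists>c. (step (padded M G) ^^ n) (init_config M w) c \<and>
     (\<forall>i\<in>{lo..<hi}. source (fst (X (lo + int n) i)) = fst c \<and>
        (\<forall>j<tape_count M. symbol (X (lo + int n) i) j = fst (snd c ! j) i \<and>
           (head (X (lo + int n) i) j \<longleftrightarrow> snd (snd c ! j) = i)))"
proof (induction n)
  case 0
  note g = coordinatesD[OF coords]
  \<comment> \<open>The unary condition is available only inside the binary relation, so some other
    cell has to act as partner; the one in the next row will do.\<close>
  have "initial M (g lo) (g i) (X lo i)" if "i \<in> {lo..<hi}" for i
  proof -
    have "lo + 1 \<in> {lo..<hi}" "lo \<in> {lo..<hi}" using range by auto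
    then have "compatible M (lo - (lo + 1)) (i - i) (g lo) (g i) (X lo i) (g (lo + 1)) (g i) (X (lo + 1) i)"
      using that by (intro valid_tableau_compatible[OF X]) auto
    then show ?thesis by (simp add: compatible_def)
  qed
  moreover have "g lo = 7" using g(3)[of lo] range by auto
  ultimately have init: "source (fst (X lo i)) = start_state M" "j < tape_count M \<Longrightarrow>
      symbol (X lo i) j = (if j = 0 then word_tape w i else 0) \<and> (head (X lo i) j \<longleftrightarrow> i = 0)"
    if "i \<in> {lo..<hi}" for i j
    using that g(1,2)[of i] by (auto simp: initial_def)
  have "tape_count M \<ge> 1" using wf by (auto simp: tm_wf_def)
  then have "snd (init_config M w) ! j = (if j = 0 then word_tape w else word_tape [], 0)"
    if "j < tape_count M" for j
    using that by (auto simp: init_config_def nth_Cons')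
  then show ?case
    using init by (auto simp: init_config_def word_tape_def)
next
  case (Suc n)
  define t where "t = lo + int n"
  have t: "t \<in> {lo..<hi}" "t + 1 \<in> {lo..<hi}" "lo + int (Suc n) = t + 1" "lo \<in> {lo..<hi}"
    using Suc.prems by (auto simp: t_def)
  obtain c where run: "(step (padded M G) ^^ n) (init_config M w) c"
    and row: "\<And>i. i \<in> {lo..<hi} \<Longrightarrow> source (fst (X t i)) = fst c"
    "\<And>i j. i \<in> {lo..<hi} \<Longrightarrow> j < tape_count M \<Longrightarrow> symbol (X t i) j = fst (snd c ! j) i"
    "\<And>i j. i \<in> {lo..<hi} \<Longrightarrow> j < tape_count M \<Longrightarrow> head (X t i) j \<longleftrightarrow> snd (snd c ! j) = i"
    using Suc unfolding t_def by fastforce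
  have reach: "length (snd c) = tape_count M \<and> (\<forall>j<tape_count M. snd (snd c ! j) \<in> {lo..<hi})"
    if c: "(step (padded M G) ^^ n) (init_config M w) c" for n c
  proof -
    obtain m where m: "(step M ^^ m) (init_config M w) c"
      using steps_padded_cases[OF c] by blast
    have "config_bounded M G m c" using config_bounded_steps[OF wf m] .
    moreover have "m \<le> B" using time m by blast
    ultimately show ?thesis
      using range unfolding config_bounded_def by fastforce
  qed
  define tr where "tr = fst (X t lo)"
  have compatible: "compatible M (t1 - t2) (i1 - i2) (g t1) (g i1) (X t1 i1) (g t2) (g i2) (X t2 i2)"
    if "t1 \<in> {lo..<hi}" "i1 \<in> {lo..<hi}" "t2 \<in> {lo..<hi}" "i2 \<in> {lo..<hi}" "(t1, i1) \<noteq> (t2, i2)"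
    for t1 i1 t2 i2
    using that by (intro valid_tableau_compatible[OF X])
  have same: "fst (X t i) = tr" if "i \<in> {lo..<hi}" for i
    using compatible[OF t(1) that t(1) t(4)] unfolding tr_def by (cases "i = lo") (auto simp: compatible_def)
  have next_row: "succ_row M (i2 - i1) (X t i1) (X (t + 1) i2)"
    if "i1 \<in> {lo..<hi}" "i2 \<in> {lo..<hi}" for i1 i2
    using compatible[OF t(1) that(1) t(2) that(2)] by (auto simp: compatible_def)
  have in_letters: "X t i \<in> letters M G" if "i \<in> {lo..<hi}" for i
    using X t(1) that by (auto simp: valid_tableau_def)
  have tr: "tr \<in> transitions (padded M G)"
    using in_letters[OF t(4)] by (simp add: letters_def tr_def)
  note len = tm_wf_padded[OF wf(1) tr]
  \<comment> \<open>Each tape has its head in some cell of the row, and that cell was checked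
    against its entry of \<open>scanned\<close>; together they show that the recorded transition is
    applicable.\<close>
  have "map read_tape (snd c) = scanned tr"
  proof (rule nth_equalityI)
    show "length (map read_tape (snd c)) = length (scanned tr)"
      using len reach[OF run] by simp
    fix j assume "j < length (map read_tape (snd c))"
    then have j: "j < tape_count M" using reach[OF run] by simp
    define h where "h = snd (snd c ! j)"
    have h: "h \<in> {lo..<hi}" using reach[OF run] j by (simp add: h_def)
    then have "symbol (X t h) j = scanned tr ! j"
      using in_letters[OF h] same[OF h] row(3)[OF h j] j by (simp add: letters_def h_def)
    then show "map read_tape (snd c) ! j = scanned tr ! j"
      using row(2)[OF h j] reach[OF run] j by (simp add: read_tape_eq h_def)
  qed
  moreover define c' where "c' = (target tr, map2 act_tape (actions tr) (snd c))"
  ultimately have st: "step (padded M G) c c'"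
    using tr row(1)[OF t(4)] unfolding step_def
    by (cases tr) (auto simp: tr_def[symmetric] intro!: exI[of _ "target tr"] exI[of _ "actions tr"])
  then have run': "(step (padded M G) ^^ Suc n) (init_config M w) c'"
    using run by auto
  have tape': "snd c' ! j = act_tape (actions tr ! j) (snd c ! j)" if "j < tape_count M" for j
    using that len reach[OF run] by (simp add: c'_def)
  have "source (fst (X (t + 1) i)) = fst c' \<and> (\<forall>j<tape_count M. symbol (X (t + 1) i) j = fst (snd c' ! j) i \<and>
           (head (X (t + 1) i) j \<longleftrightarrow> snd (snd c' ! j) = i))" if i: "i \<in> {lo..<hi}" for i
  proof (intro conjI allI impI)
    show "source (fst (X (t + 1) i)) = fst c'"
      using next_row[OF i i] same[OF i] by (simp add: succ_row_def c'_def)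
    fix j assume j: "j < tape_count M"
    show "symbol (X (t + 1) i) j = fst (snd c' ! j) i"
      using next_row[OF i i] same[OF i] row(2,3)[OF i j] j
      by (auto simp: succ_row_def tape' act_tape_eq)
    define h h' where "h = snd (snd c ! j)" and "h' = snd (snd c' ! j)"
    have h: "h \<in> {lo..<hi}" and h': "h' \<in> {lo..<hi}"
      using reach[OF run] reach[OF run'] j by (simp_all add: h_def h'_def)
    have "h' - h = disp (snd (actions tr ! j))"
      using tape'[OF j] by (simp add: h_def h'_def act_tape_eq shift_head_disp)
    \<comment> \<open>The successor constraint forces a marker at the new head position; uniqueness
      within the row then excludes every other one.\<close>
    then have "head (X (t + 1) h') j"
      using next_row[OF h h'] same[OF h] row(3)[OF h j] j by (simp add: succ_row_def h_def)
    moreover have "\<not> (head (X (t + 1) i) j \<and> head (X (t + 1) h') j)" if "i \<noteq> h'"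
      using compatible[OF t(2) i t(2) h'] that j by (simp add: compatible_def)
    ultimately show "head (X (t + 1) i) j \<longleftrightarrow> snd (snd c' ! j) = i"
      by (auto simp: h'_def)
  qed
  with run' show ?case unfolding t(3) by blast
qed

text \<open>The last of the \<open>hi - lo\<close> rows records a transition as well, hence a run of
  \<open>hi - lo\<close> steps. A head outside the window would simply mark no cell.\<close>

lemma run_valid_tableau:
  assumes wf: "tm_wf M" "symbols_below M G"
    and coords: "coordinates w g lo hi"
    and run: "(step (padded M G) ^^ nat (hi - lo)) (init_config M w) c"
  shows "\<exists>X. valid_tableau M G g lo hi X"
proof -
  let ?n = "nat (hi - lo)" and ?K = "tape_count M"
  note g = coordinatesD[OF coords]
  obtain f where f: "f 0 = init_config M w" "\<And>k. k < ?n \<Longrightarrow> step (padded M G) (f k) (f (Suc k))"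
    using run unfolding relpowp_fun_conv by blast
  have "\<forall>k. k < ?n \<longrightarrow> (\<exists>tr. tr \<in> transitions (padded M G) \<and> source tr = fst (f k) \<and>
      scanned tr = map read_tape (snd (f k)) \<and>
      f (Suc k) = (target tr, map2 act_tape (actions tr) (snd (f k))))"
    using f(2) unfolding step_def by (metis source.simps scanned.simps target.simps actions.simps)
  then obtain tr where tr: "\<And>k. k < ?n \<Longrightarrow> tr k \<in> transitions (padded M G)"
    "\<And>k. k < ?n \<Longrightarrow> source (tr k) = fst (f k)"
    "\<And>k. k < ?n \<Longrightarrow> scanned (tr k) = map read_tape (snd (f k))"
    "\<And>k. k < ?n \<Longrightarrow> f (Suc k) = (target (tr k), map2 act_tape (actions (tr k)) (snd (f k)))"
    by metis
  have bounded: "\<exists>m. config_bounded M G m (f k)" if "k \<le> ?n" for k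
  proof -
    have "(step (padded M G) ^^ k) (init_config M w) (f k)"
      using f that unfolding relpowp_fun_conv by (intro exI[of _ f]) auto
    then obtain m where "(step M ^^ m) (init_config M w) (f k)"
      using steps_padded_cases by blast
    then show ?thesis using config_bounded_steps[OF wf] by blast
  qed
  then have len: "length (snd (f k)) = ?K" and sym: "\<And>j x. j < ?K \<Longrightarrow> fst (snd (f k) ! j) x < G"
    if "k \<le> ?n" for k
    using that unfolding config_bounded_def by blast+
  define X :: "int \<Rightarrow> int \<Rightarrow> letter" where
    "X t i = (tr (nat (t - lo)), map (\<lambda>u. (fst u i, snd u = i)) (snd (f (nat (t - lo)))))" for t i
  have X: "fst (X t i) = tr (nat (t - lo))"
    "j < ?K \<Longrightarrow> symbol (X t i) j = fst (snd (f (nat (t - lo))) ! j) i"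
    "j < ?K \<Longrightarrow> head (X t i) j \<longleftrightarrow> snd (snd (f (nat (t - lo))) ! j) = i"
    "length (snd (X t i)) = ?K"
    if "t \<in> {lo..<hi}" for t i j
    using that len[of "nat (t - lo)"] by (auto simp: X_def symbol_def head_def)
  have in_letters: "X t i \<in> letters M G" if t: "t \<in> {lo..<hi}" for t i
    using t tr(1,3)[of "nat (t - lo)"] sym[of "nat (t - lo)"] len[of "nat (t - lo)"]
    by (auto simp: letters_def X read_tape_eq)
  have initial: "initial M (g t) (g i) (X t i)" if t: "t \<in> {lo..<hi}" and i: "i \<in> {lo..<hi}" for t i
    unfolding initial_def
  proof (intro impI)
    assume "g t = 7"
    then have "t = lo" using g(3)[of t] t by auto
    moreover have "?K \<ge> 1" using wf by (auto simp: tm_wf_def)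
    ultimately show "source (fst (X t i)) = start_state M \<and> (\<forall>j<?K. symbol (X t i) j =
        (if j = 0 then decode (g i) else 0) \<and> (head (X t i) j \<longleftrightarrow> g i \<in> {4, 5, 6}))"
      using t i g(1,2)[of i] tr(2)[of 0] f(1)
      by (auto simp: X init_config_def nth_Cons' word_tape_def)
  qed
  have succ: "succ_row M (i' - i) (X t i) (X (t + 1) i')"
    if t: "t \<in> {lo..<hi}" "t + 1 \<in> {lo..<hi}" for t i i'
  proof -
    define k where "k = nat (t - lo)"
    have k: "k < ?n" "Suc k < ?n" "nat (t + 1 - lo) = Suc k" using t by (auto simp: k_def)
    have la: "length (actions (tr k)) = ?K"
      using tm_wf_padded(2)[OF wf(1)] tr(1)[OF k(1)] by blast
    have "snd (f (Suc k)) ! j = act_tape (actions (tr k) ! j) (snd (f k) ! j)" if "j < ?K" for j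
      using that la len[of k] k(1) by (simp add: tr(4)[OF k(1)])
    then show ?thesis
      using tr(2)[OF k(2)] tr(4)[OF k(1)] t
      by (auto simp: succ_row_def X k k_def[symmetric] act_tape_eq shift_head_disp)
  qed
  have "compatible M (t - t') (i - i') (g t) (g i) (X t i) (g t') (g i') (X t' i')"
    if r: "t \<in> {lo..<hi}" "i \<in> {lo..<hi}" "t' \<in> {lo..<hi}" "i' \<in> {lo..<hi}" and ne: "(t, i) \<noteq> (t', i')"
    for t i t' i'
    unfolding compatible_def
  proof (intro conjI impI)
    assume "t - t' = 0"
    with r ne show "fst (X t i) = fst (X t' i')" "\<forall>j<?K. \<not> (head (X t i) j \<and> head (X t' i') j)"
      by (auto simp: X)
  next
    assume "t - t' = - 1"
    then have "t' = t + 1" by simp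
    with r succ[of t i' i] show "succ_row M (- (i - i')) (X t i) (X t' i')" by simp
  next
    assume "t - t' = 1"
    then have "t = t' + 1" by simp
    with r succ[of t' i i'] show "succ_row M (i - i') (X t' i') (X t i)" by simp
  qed (use r initial in blast)+
  with in_letters have "valid_tableau M G g lo hi X"
    unfolding valid_tableau_def by blast
  then show ?thesis by blast
qed

section \<open>Printing the instance in polynomial time\<close>

lemma writes_below_skip: "writes_below G skip"
  by (auto simp: skip_def keep_def)

lemma writes_below_unroll [simp]: "(\<And>k. k < n \<Longrightarrow> writes_below G (c k)) \<Longrightarrow> writes_below G (unroll n c)"
  by (induction n) (auto simp: writes_below_skip)

lemma writes_below_For [simp]: "writes_below G (For x y s c) \<longleftrightarrow> writes_below G c"
  by (auto simp: For_def go_def)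

lemma writes_below_Emit [simp]: "3 \<le> G \<Longrightarrow> writes_below G (Emit b)"
  by (auto simp: Emit_def)

text \<open>The tapes come in groups of equal behaviour: 0 is the input, 1 the output, 2 to 5 are coordinate tapes, 6 and 7
  hold coordinate differences, and the tapes from 8 on are the counters of \<open>nest\<close>.\<close>

definition Grp :: "(nat \<Rightarrow> nat \<times> move) \<Rightarrow> (nat \<Rightarrow> nat \<Rightarrow> nat \<times> move) \<Rightarrow> (nat \<Rightarrow> nat \<times> move) \<Rightarrow>
    (nat \<Rightarrow> nat \<times> move) \<Rightarrow> com" where
  "Grp fa fb fd fu = Do (\<lambda>r j. if j = 0 then fa (r 0) else if j = 1 then (r 1, Stay)
     else if j \<le> 5 then fb (r 0) (r j) else if j \<le> 7 then fd (r j) else fu (r j))"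

definition store :: "nat \<Rightarrow> tape \<Rightarrow> tape \<Rightarrow> tape \<Rightarrow> tape \<Rightarrow> store" where
  "store d ta tb td tu j = (if j = 0 then ta else if j = 1 then (word_tape [], 0)
     else if j \<le> 5 then tb else if j \<le> 7 then td else if j < 8 + d then tu else (word_tape [], 0))"

lemma runs_Grp:
  "runs (8 + d) (Grp fa fb fd fu) (store d ta tb td tu)
     (store d (act_tape (fa (read_tape ta)) ta) (act_tape (fb (read_tape ta) (read_tape tb)) tb)
        (act_tape (fd (read_tape td)) td) (act_tape (fu (read_tape tu)) tu)) 1"
proof -
  let ?f = "\<lambda>r j. if j = 0 then fa (r 0) else if j = 1 then (r 1, Stay)
     else if j \<le> 5 then fb (r 0) (r j) else if j \<le> 7 then fd (r j) else fu (r j)"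
  let ?\<sigma> = "store d ta tb td tu"
  have "perform (8 + d) (?f (reads (8 + d) ?\<sigma>)) ?\<sigma> =
     store d (act_tape (fa (read_tape ta)) ta) (act_tape (fb (read_tape ta) (read_tape tb)) tb)
        (act_tape (fd (read_tape td)) td) (act_tape (fu (read_tape tu)) tu)"
    by (auto simp: fun_eq_iff perform_def reads_def store_def act_tape_eq read_tape_eq)
  then show ?thesis
    using exec_Do[of "8 + d" ?f ?\<sigma>] by (auto simp: runs_def Grp_def)
qed

section \<open>Writing the static tapes\<close>

definition stay :: "nat \<Rightarrow> nat \<times> move" where "stay x = (x, Stay)"

lemma act_stay [simp]: "act_tape (stay (read_tape t)) t = t"
  by (cases t) (auto simp: stay_def)

lemma act_stay_pair [simp]: "act_tape (stay (f h)) (f, h) = (f, h)"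
  using act_stay[of "(f, h)"] by simp

text \<open>Content of a difference tape: with the head on cell \<open>z\<close>, the symbol read
  codes the clipped value of \<open>z\<close>, the blank standing for far.\<close>

definition delta :: "int \<Rightarrow> nat" where
  "delta z = (if z = 0 then 1 else if z = 1 then 2 else if z = - 1 then 3 else 0)"

definition write_delta :: com where
  "write_delta = Grp stay (\<lambda>_. stay) (\<lambda>_. (1, Right)) stay ;; Grp stay (\<lambda>_. stay) (\<lambda>_. (2, Left)) stay ;;
     Grp stay (\<lambda>_. stay) (\<lambda>x. (x, Left)) stay ;; Grp stay (\<lambda>_. stay) (\<lambda>_. (3, Right)) stay"

lemma runs_write_delta:
  "runs (8 + d) write_delta (store d ta tb (word_tape [], 0) tu) (store d ta tb (delta, 0) tu) 4"
proof -
  let ?K = "8 + d"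
  let ?z = "word_tape []"
  have 1: "runs ?K (Grp stay (\<lambda>_. stay) (\<lambda>_. (1, Right)) stay) (store d ta tb (?z, 0) tu)
     (store d ta tb (?z(0 := 1), 1) tu) 1"
    using runs_Grp[of d stay "\<lambda>_. stay" "\<lambda>_. (1, Right)" stay ta tb "(?z, 0)" tu] by simp
  have 2: "runs ?K (Grp stay (\<lambda>_. stay) (\<lambda>_. (2, Left)) stay) (store d ta tb (?z(0 := 1), 1) tu)
     (store d ta tb (?z(0 := 1, 1 := 2), 0) tu) 1"
    using runs_Grp[of d stay "\<lambda>_. stay" "\<lambda>_. (2, Left)" stay ta tb "(?z(0 := 1), 1)" tu] by simp
  have 3: "runs ?K (Grp stay (\<lambda>_. stay) (\<lambda>x. (x, Left)) stay) (store d ta tb (?z(0 := 1, 1 := 2), 0) tu)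
     (store d ta tb (?z(0 := 1, 1 := 2), - 1) tu) 1"
    using runs_Grp[of d stay "\<lambda>_. stay" "\<lambda>x. (x, Left)" stay ta tb "(?z(0 := 1, 1 := 2), 0)" tu]
    by (simp add: fun_upd_idem)
  have "?z(0 := 1, 1 := 2, - 1 := 3) = delta"
    by (auto simp: fun_eq_iff delta_def word_tape_def)
  then have 4: "runs ?K (Grp stay (\<lambda>_. stay) (\<lambda>_. (3, Right)) stay)
     (store d ta tb (?z(0 := 1, 1 := 2), - 1) tu) (store d ta tb (delta, 0) tu) 1"
    using runs_Grp[of d stay "\<lambda>_. stay" "\<lambda>_. (3, Right)" stay ta tb "(?z(0 := 1, 1 := 2), - 1)" tu] by simp
  show ?thesis
    unfolding write_delta_def
    by (rule runs_mono[OF runs_Seq[OF 1 runs_Seq[OF 2 runs_Seq[OF 3 4]]]]) simp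
qed

definition unary :: "nat \<Rightarrow> int \<Rightarrow> nat" where
  "unary n i = (if 0 \<le> i \<and> i < int n then 1 else 0)"

text \<open>The shift keeps input blanks from looking like the end of a loop; the larger shift at 0
  marks the origin.\<close>

definition coded :: "bool list \<Rightarrow> nat \<Rightarrow> int \<Rightarrow> nat" where
  "coded w n i = (if 0 \<le> i \<and> i < int n then word_tape w i + (if i = 0 then 4 else 1) else 0)"

text \<open>The first cell is written unconditionally: it takes the offset 4, and it gives even the
  empty input one cell, whence the length \<open>max 1 (length w)\<close>. The cap at 7 keeps
  written symbols below 8.\<close>

definition copy_input :: com where
  "copy_input = Grp (\<lambda>x. (x, Right)) (\<lambda>a _. (min 7 (a + 4), Right)) stay (\<lambda>_. (1, Right)) ;;
     While (\<lambda>r. r 0 \<noteq> 0) (Grp (\<lambda>x. (x, Right)) (\<lambda>a _. (min 7 (a + 1), Right)) stay (\<lambda>_. (1, Right)))"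

lemma word_tape_le: "word_tape w i \<le> 2"
  by (auto simp: word_tape_def)

lemma runs_copy_input:
  fixes w :: "bool list"
  defines "U \<equiv> max 1 (length w)"
  shows "runs (8 + d) copy_input (store d (word_tape w, 0) (word_tape [], 0) td (word_tape [], 0))
     (store d (word_tape w, int U) (coded w U, int U) td (unary U, int U)) (3 * U)"
proof -
  let ?K = "8 + d"
  let ?S = "\<lambda>n. store d (word_tape w, int n) (coded w n, int n) td (unary n, int n)"
  have z: "coded w 0 = word_tape []" "unary 0 = word_tape []"
    by (auto simp: fun_eq_iff coded_def unary_def word_tape_def)
  have step: "runs ?K (Grp (\<lambda>x. (x, Right)) (\<lambda>a _. (min 7 (a + b), Right)) stay (\<lambda>_. (1, Right)))
      (?S n) (?S (Suc n)) 1" if "b = (if n = 0 then 4 else 1)" for n b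
  proof -
    have "(coded w n)(int n := min 7 (word_tape w (int n) + b)) = coded w (Suc n)"
      using that word_tape_le[of w "int n"] by (auto simp: fun_eq_iff coded_def)
    moreover have "(unary n)(int n := 1) = unary (Suc n)"
      by (auto simp: fun_eq_iff unary_def)
    ultimately show ?thesis
      using runs_Grp[of d "\<lambda>x. (x, Right)" "\<lambda>a _. (min 7 (a + b), Right)" stay "\<lambda>_. (1, Right)"
          "(word_tape w, int n)" "(coded w n, int n)" td "(unary n, int n)"]
      by (simp add: add.commute)
  qed
  have "runs ?K (While (\<lambda>r. r 0 \<noteq> 0)
      (Grp (\<lambda>x. (x, Right)) (\<lambda>a _. (min 7 (a + 1), Right)) stay (\<lambda>_. (1, Right))))
      (?S (Suc 0)) (?S (Suc (U - 1))) ((U - 1) * (1 + 2) + 1)"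
  proof (rule runs_While[where \<tau> = "\<lambda>k. ?S (Suc k)"])
    fix k assume "k < U - 1"
    then have "Suc k < length w" by (auto simp: U_def)
    then have "reads ?K (?S (Suc k)) 0 \<noteq> 0"
      by (auto simp: reads_def store_def word_tape_def)
    then show "reads ?K (?S (Suc k)) 0 \<noteq> 0 \<and> runs ?K
        (Grp (\<lambda>x. (x, Right)) (\<lambda>a _. (min 7 (a + 1), Right)) stay (\<lambda>_. (1, Right)))
        (?S (Suc k)) (?S (Suc (Suc k))) 1"
      using step[of 1 "Suc k"] by auto
  next
    show "\<not> reads ?K (?S (Suc (U - 1))) 0 \<noteq> 0"
      by (auto simp: reads_def store_def word_tape_def U_def)
  qed
  then have 1: "runs ?K copy_input (?S 0) (?S (Suc (U - 1))) (1 + ((U - 1) * (1 + 2) + 1))"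
    unfolding copy_input_def using step[of 4 0] by (intro runs_Seq) auto
  have "runs ?K copy_input (?S 0) (?S (Suc (U - 1))) (3 * U)"
    by (rule runs_mono[OF 1]) (auto simp: U_def)
  moreover have "Suc (U - 1) = U" by (simp add: U_def)
  ultimately show ?thesis by (simp add: z)
qed

definition rewind_unary :: com where
  "rewind_unary = Grp stay (\<lambda>_. stay) stay (\<lambda>x. (x, Left)) ;;
     While (\<lambda>r. r 8 \<noteq> 0) (Grp stay (\<lambda>_. stay) stay (\<lambda>x. (x, Left))) ;;
     Grp stay (\<lambda>_. stay) stay (\<lambda>x. (x, Right))"

lemma act_move [simp]: "act_tape (read_tape (f, h), m) (f, h) = (f, h + disp m)"
  by (auto simp: shift_head_disp)

lemma runs_rewind_unary:
  assumes "0 < d"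
  shows "runs (8 + d) rewind_unary (store d ta tb td (unary U, int U)) (store d ta tb td (unary U, 0)) (3 * U + 3)"
proof -
  let ?K = "8 + d"
  let ?S = "\<lambda>h. store d ta tb td (unary U, h)"
  let ?L = "Grp stay (\<lambda>_. stay) stay (\<lambda>x. (x, Left))"
  have left: "runs ?K ?L (?S h) (?S (h - 1)) 1" for h
    using runs_Grp[of d stay "\<lambda>_. stay" stay "\<lambda>x. (x, Left)" ta tb td "(unary U, h)"]
    by (simp del: read_tape.simps act_tape.simps)
  have right: "runs ?K (Grp stay (\<lambda>_. stay) stay (\<lambda>x. (x, Right))) (?S (- 1)) (?S 0) 1"
    using runs_Grp[of d stay "\<lambda>_. stay" stay "\<lambda>x. (x, Right)" ta tb td "(unary U, - 1)"]
    by (simp del: read_tape.simps act_tape.simps)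
  have "runs ?K (While (\<lambda>r. r 8 \<noteq> 0) ?L) (?S (int U - 1 - int 0)) (?S (int U - 1 - int U)) (U * (1 + 2) + 1)"
  proof (rule runs_While[where \<tau> = "\<lambda>k. ?S (int U - 1 - int k)"])
    fix k assume "k < U"
    then show "reads ?K (?S (int U - 1 - int k)) 8 \<noteq> 0 \<and>
        runs ?K ?L (?S (int U - 1 - int k)) (?S (int U - 1 - int (Suc k))) 1"
      using left[of "int U - 1 - int k"] assms by (auto simp: reads_def store_def unary_def algebra_simps)
  qed (auto simp: reads_def store_def unary_def)
  then have "runs ?K (While (\<lambda>r. r 8 \<noteq> 0) ?L) (?S (int U - 1)) (?S (- 1)) (U * (1 + 2) + 1)" by simp
  from runs_Seq[OF left runs_Seq[OF this right]] show ?thesis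
    unfolding rewind_unary_def by (rule runs_mono) simp
qed

definition rewind_cells :: com where
  "rewind_cells = Grp stay (\<lambda>_ x. (x, Left)) stay stay ;;
     While (\<lambda>r. r 2 \<noteq> 0) (Grp stay (\<lambda>_ x. (x, Left)) stay stay)"

lemma runs_rewind_cells:
  assumes "\<And>i. 0 \<le> i \<Longrightarrow> i < int m \<Longrightarrow> f i \<noteq> 0" "f (- 1) = 0"
  shows "runs (8 + d) rewind_cells (store d ta (f, int m) td tu) (store d ta (f, - 1) td tu) (3 * m + 2)"
proof -
  let ?K = "8 + d"
  let ?S = "\<lambda>h. store d ta (f, h) td tu"
  let ?L = "Grp stay (\<lambda>_ x. (x, Left)) stay stay"
  have left: "runs ?K ?L (?S h) (?S (h - 1)) 1" for h
    using runs_Grp[of d stay "\<lambda>_ x. (x, Left)" stay stay ta "(f, h)" td tu]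
    by (simp del: read_tape.simps act_tape.simps)
  have "runs ?K (While (\<lambda>r. r 2 \<noteq> 0) ?L) (?S (int m - 1 - int 0)) (?S (int m - 1 - int m)) (m * (1 + 2) + 1)"
  proof (rule runs_While[where \<tau> = "\<lambda>k. ?S (int m - 1 - int k)"])
    fix k assume "k < m"
    then show "reads ?K (?S (int m - 1 - int k)) 2 \<noteq> 0 \<and>
        runs ?K ?L (?S (int m - 1 - int k)) (?S (int m - 1 - int (Suc k))) 1"
      using left[of "int m - 1 - int k"] assms(1)[of "int m - 1 - int k"]
      by (auto simp: reads_def store_def algebra_simps)
  qed (use assms in \<open>auto simp: reads_def store_def\<close>)
  then have "runs ?K (While (\<lambda>r. r 2 \<noteq> 0) ?L) (?S (int m - 1)) (?S (- 1)) (m * (1 + 2) + 1)" by simp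
  from runs_Seq[OF left this] show ?thesis
    unfolding rewind_cells_def by (rule runs_mono) simp
qed

text \<open>\<open>For\<close> always drags a second tape along; tape 6 is a dummy here and is back
  in place after each loop.\<close>

fun nest :: "nat \<Rightarrow> com \<Rightarrow> com" where
  "nest 0 c = c"
| "nest (Suc j) c = For (8 + j) 6 Right (nest j c)"

fun nest_time :: "nat \<Rightarrow> nat \<Rightarrow> nat \<Rightarrow> nat" where
  "nest_time U T 0 = T"
| "nest_time U T (Suc j) = U * (nest_time U T j + 6) + 6"

lemma fold_const_funpow: "fold (\<lambda>_. e) xs = e ^^ length xs"
  by (induction xs) (auto simp: funpow_Suc_right simp del: funpow.simps)

lemma does_nest:
  assumes "\<And>\<sigma>. does (8 + d) c \<sigma> {2..5} e T"
  shows "j \<le> d \<Longrightarrow> (\<And>i. i < j \<Longrightarrow> spans (\<sigma> (8 + i)) U) \<Longrightarrow>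
    does (8 + d) (nest j c) \<sigma> {2..5} (e ^^ (U ^ j)) (nest_time U T j)"
proof (induction j arbitrary: \<sigma>)
  case 0
  then show ?case using assms by simp
next
  case (Suc j)
  have "does (8 + d) (For (8 + j) 6 Right (nest j c)) \<sigma> {2..5}
      (fold (\<lambda>_. e ^^ (U ^ j)) [0..<U]) (U * (nest_time U T j + 6) + 6)"
  proof (rule does_For)
    fix k
    show "does (8 + d) (nest j c) (slide (8 + j) 6 Right (int k) \<sigma>) {2..5} (e ^^ (U ^ j)) (nest_time U T j)"
      using Suc.prems by (intro Suc.IH) (auto simp: slide_def)
  qed (use Suc.prems in auto)
  then show ?case
    by (simp add: fold_const_funpow funpow_mult mult.commute)
qed

definition fill :: "move \<Rightarrow> com" where
  "fill s = Grp stay (\<lambda>_ _. (1, s)) stay stay"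



definition mark :: "move \<Rightarrow> tape \<Rightarrow> tape" where
  "mark s = act_tape (1, s)"

lemma does_fill: "does (8 + d) (fill s) \<sigma> {2..5} (mark s) 1"
  unfolding does_def
proof (intro allI impI)
  fix \<tau> :: "nat \<Rightarrow> tape"
  let ?f = "\<lambda>r j. if j = 0 then stay (r 0) else if j = 1 then (r 1, Stay)
     else if j \<le> 5 then (1, s) else if j \<le> 7 then stay (r j) else stay (r j)"
  have "perform (8 + d) (?f (reads (8 + d) \<tau>)) \<tau> = on_tapes {2..5} (mark s) \<tau>"
    by (auto simp: fun_eq_iff perform_def on_tapes_def act_tape_eq reads_def read_tape_eq stay_def mark_def)
  then have "exec (8 + d) (fill s) \<tau> (on_tapes {2..5} (mark s) \<tau>) 1"
    using exec_Do[of "8 + d" ?f \<tau>] unfolding fill_def Grp_def by argo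
  then show "runs (8 + d) (fill s) \<tau> (on_tapes {2..5} (mark s) \<tau>) 1"
    unfolding runs_def by blast
qed

lemma mark_right: "(mark Right ^^ n) (f, h) = (\<lambda>i. if h \<le> i \<and> i < h + int n then 1 else f i, h + int n)"
  by (induction n) (auto simp: fun_eq_iff mark_def)

lemma mark_left: "(mark Left ^^ n) (f, h) = (\<lambda>i. if h - int n < i \<and> i \<le> h then 1 else f i, h - int n)"
  by (induction n) (auto simp: fun_eq_iff mark_def)

lemma spans_unary: "spans (unary U, 0) U"
  by (auto simp: spans_def unary_def)

lemma runs_nest_fill:
  "runs (8 + d) (nest d (unroll c (\<lambda>_. fill s))) (store d ta tb td (unary U, 0))
     (store d ta ((mark s ^^ (c * U ^ d)) tb) td (unary U, 0)) (nest_time U (c + 1) d)"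
proof -
  let ?\<sigma> = "store d ta tb td (unary U, 0)"
  have body: "does (8 + d) (unroll c (\<lambda>_. fill s)) \<sigma> {2..5} (mark s ^^ c) (c + 1)" for \<sigma>
    using does_unroll[of c "8 + d" "\<lambda>_. fill s" \<sigma> "{2..5}" "\<lambda>_. mark s" 1] does_fill
    by (simp add: fold_const_funpow)
  have "does (8 + d) (nest d (unroll c (\<lambda>_. fill s))) ?\<sigma> {2..5} ((mark s ^^ c) ^^ (U ^ d))
      (nest_time U (c + 1) d)"
    using body by (intro does_nest) (auto simp: store_def spans_unary)
  moreover have "on_tapes {2..5} ((mark s ^^ c) ^^ (U ^ d)) ?\<sigma> =
      store d ta ((mark s ^^ (c * U ^ d)) tb) td (unary U, 0)"
    by (auto simp: fun_eq_iff on_tapes_def store_def funpow_mult mult.commute)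
  ultimately show ?thesis by (auto simp: does_def)
qed

text \<open>The margins hold 1, which decodes to a blank. The extra cell at
  \<open>- int Q - 1\<close> carries the mark of the first row, and all other cells are blank so
  that sweeps stop.\<close>

definition ruler :: "bool list \<Rightarrow> nat \<Rightarrow> nat \<Rightarrow> int \<Rightarrow> nat" where
  "ruler w U Q i = (if i = - int Q - 1 then 7 else if - int Q \<le> i \<and> i < 0 then 1
     else if int U \<le> i \<and> i < int U + int Q then 1 else coded w U i)"

definition prepare :: "nat \<Rightarrow> nat \<Rightarrow> com" where
  "prepare c d = write_delta ;; copy_input ;; rewind_unary ;; nest d (unroll c (\<lambda>_. fill Right)) ;;
     rewind_cells ;; nest d (unroll c (\<lambda>_. fill Left)) ;; Grp stay (\<lambda>_ _. (7, Stay)) stay stay"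

lemma runs_prepare:
  fixes w :: "bool list" and c d :: nat
  defines "U \<equiv> max 1 (length w)"
  assumes "0 < d"
  defines "Q \<equiv> c * U ^ d"
  shows "runs (8 + d) (prepare c d) (start_store w)
    (store d (word_tape w, int U) (ruler w U Q, - int Q - 1) (delta, 0) (unary U, 0))
    (9 * U + 3 * Q + 2 * nest_time U (c + 1) d + 10)"
proof -
  let ?K = "8 + d" and ?z = "(word_tape [], 0) :: tape"
  \<comment> \<open>\<open>f1\<close> is the ruler once its right margin is written and
    \<open>f2\<close> has the left margin too; only the mark 7 is then missing.\<close>
  define f1 where "f1 = (\<lambda>i. if int U \<le> i \<and> i < int U + int Q then 1 else coded w U i)"
  define f2 where "f2 = (\<lambda>i. if - 1 - int Q < i \<and> i \<le> - 1 then 1 else f1 i)"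
  let ?S = "\<lambda>ta tb tu. store d ta tb (delta, 0) tu"
  have "start_store w = store d (word_tape w, 0) ?z ?z ?z"
    by (auto simp: fun_eq_iff start_store_def store_def)
  then have 1: "runs ?K write_delta (start_store w) (?S (word_tape w, 0) ?z ?z) 4"
    using runs_write_delta[of d "(word_tape w, 0)" ?z ?z] by simp
  have 2: "runs ?K copy_input (?S (word_tape w, 0) ?z ?z)
      (?S (word_tape w, int U) (coded w U, int U) (unary U, int U)) (3 * U)"
    unfolding U_def by (rule runs_copy_input)
  have 3: "runs ?K rewind_unary (?S (word_tape w, int U) (coded w U, int U) (unary U, int U))
      (?S (word_tape w, int U) (coded w U, int U) (unary U, 0)) (3 * U + 3)"
    by (rule runs_rewind_unary) fact
  have 4: "runs ?K (nest d (unroll c (\<lambda>_. fill Right))) (?S (word_tape w, int U) (coded w U, int U) (unary U, 0))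
      (?S (word_tape w, int U) (f1, int (U + Q)) (unary U, 0)) (nest_time U (c + 1) d)"
    using runs_nest_fill[of d c Right "(word_tape w, int U)" "(coded w U, int U)" "(delta, 0)" U]
    by (simp add: Q_def[symmetric] mark_right f1_def)
  have 5: "runs ?K rewind_cells (?S (word_tape w, int U) (f1, int (U + Q)) (unary U, 0))
      (?S (word_tape w, int U) (f1, - 1) (unary U, 0)) (3 * (U + Q) + 2)"
  proof (rule runs_rewind_cells)
    fix i assume i: "0 \<le> i" "i < int (U + Q)"
    have "word_tape w i + (if i = 0 then 4 else 1) \<noteq> 0" by auto
    then show "f1 i \<noteq> 0" using i unfolding f1_def coded_def by auto
  qed (auto simp: f1_def coded_def)
  have hd: "- 1 - int Q = - int Q - 1" by simp
  have 6: "runs ?K (nest d (unroll c (\<lambda>_. fill Left))) (?S (word_tape w, int U) (f1, - 1) (unary U, 0))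
      (?S (word_tape w, int U) (f2, - int Q - 1) (unary U, 0)) (nest_time U (c + 1) d)"
    using runs_nest_fill[of d c Left "(word_tape w, int U)" "(f1, - 1)" "(delta, 0)" U]
    by (simp add: Q_def[symmetric] mark_left f2_def hd)
  have "f2(- int Q - 1 := 7) = ruler w U Q"
    by (auto simp: fun_eq_iff f1_def f2_def ruler_def)
  then have 7: "runs ?K (Grp stay (\<lambda>_ _. (7, Stay)) stay stay)
      (?S (word_tape w, int U) (f2, - int Q - 1) (unary U, 0))
      (?S (word_tape w, int U) (ruler w U Q, - int Q - 1) (unary U, 0)) 1"
    using runs_Grp[of d stay "\<lambda>_ _. (7, Stay)" stay stay "(word_tape w, int U)" "(f2, - int Q - 1)"
        "(delta, 0)" "(unary U, 0)"] by simp
  show ?thesis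
    unfolding prepare_def
    by (rule runs_mono[OF runs_Seq[OF 1 runs_Seq[OF 2 runs_Seq[OF 3 runs_Seq[OF 4 runs_Seq[OF 5 runs_Seq[OF 6 7]]]]]]])
      simp
qed

lemma writes_below_Grp:
  assumes "\<And>x. x < 8 \<Longrightarrow> fst (fa x) < 8" "\<And>x y. x < 8 \<Longrightarrow> y < 8 \<Longrightarrow> fst (fb x y) < 8"
    "\<And>x. x < 8 \<Longrightarrow> fst (fd x) < 8" "\<And>x. x < 8 \<Longrightarrow> fst (fu x) < 8"
  shows "writes_below 8 (Grp fa fb fd fu)"
  using assms by (auto simp: Grp_def)

lemma writes_below_nest [simp]: "writes_below G (nest j c) \<longleftrightarrow> writes_below G c"
  by (induction j) auto

lemma writes_below_prepare: "writes_below 8 (prepare c d)"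
  unfolding prepare_def write_delta_def copy_input_def rewind_unary_def rewind_cells_def fill_def
  by (simp only: writes_below.simps writes_below_nest; intro conjI writes_below_Grp writes_below_unroll; simp add: stay_def)

section \<open>Printing the two unary numbers and the adjacency matrix\<close>

lemma does_unroll_emits:
  assumes "\<And>k. k < n \<Longrightarrow> does K (c k) \<sigma> {1} (emits (bs k)) T"
  shows "does K (unroll n c) \<sigma> {1} (emits (concat (map bs [0..<n]))) (n * T + 1)"
  using does_unroll[of n K c \<sigma> "{1}" "\<lambda>k. emits (bs k)" T] assms by (simp add: fold_emits)

definition sweep_time :: "nat \<Rightarrow> nat \<Rightarrow> nat" where
  "sweep_time m T = m * (m * (T + 6) + 6 + 6) + 6"

lemma does_For_For:
  assumes "{x, y, x', y'} \<subseteq> {2..<K}" "distinct [x, y, x', y']"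
    and "spans (\<sigma> x) m" "spans (\<sigma> x') m"
    and body: "\<And>t i. t < m \<Longrightarrow> i < m \<Longrightarrow>
      does K c (slide x' y' s' (int i) (slide x y s (int t) \<sigma>)) {1} (emits (bs t i)) T"
  shows "does K (For x y s (For x' y' s' c)) \<sigma> {1}
    (emits (concat (map (\<lambda>t. concat (map (bs t) [0..<m])) [0..<m]))) (sweep_time m T)"
proof -
  have "does K (For x y s (For x' y' s' c)) \<sigma> {1}
      (fold (\<lambda>t. emits (concat (map (bs t) [0..<m]))) [0..<m]) (m * (m * (T + 6) + 6 + 6) + 6)"
  proof (rule does_For)
    fix t assume t: "t < m"
    have "does K (For x' y' s' c) (slide x y s (int t) \<sigma>) {1} (fold (\<lambda>i. emits (bs t i)) [0..<m]) (m * (T + 6) + 6)"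
      using assms t by (intro does_For body) (auto simp: slide_def)
    then show "does K (For x' y' s' c) (slide x y s (int t) \<sigma>) {1} (emits (concat (map (bs t) [0..<m]))) (m * (T + 6) + 6)"
      by (simp add: fold_emits)
  qed (use assms in auto)
  then show ?thesis by (simp add: fold_emits sweep_time_def)
qed

definition undelta :: "nat \<Rightarrow> int" where
  "undelta c = (if c = 1 then 0 else if c = 2 then 1 else if c = 3 then - 1 else 2)"

lemma undelta_delta: "undelta (delta z) = clip z"
  by (auto simp: undelta_def delta_def clip_def)

text \<open>\<open>csp_adj\<close> in terms of what the heads see: two vertices share their variable
  iff both differences are 0, and indices from \<open>length gs\<close> on are universal.\<close>

definition adj_bit :: "tm \<Rightarrow> letter list \<Rightarrow> nat \<Rightarrow> nat \<Rightarrow> int \<Rightarrow> int \<Rightarrow> nat \<Rightarrow> nat \<Rightarrow> nat \<Rightarrow> nat \<Rightarrow> bool" where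
  "adj_bit M gs a b dt di ct ci ct' ci' \<longleftrightarrow>
     (if length gs \<le> a \<or> length gs \<le> b then \<not> (dt = 0 \<and> di = 0 \<and> a = b)
      else \<not> (dt = 0 \<and> di = 0) \<and> compatible M dt di ct ci (gs ! a) ct' ci' (gs ! b))"

text \<open>The outer loops run over a cell \<open>(t, i)\<close> and push tapes 6 and 7 to the
  right, the inner ones over \<open>(t', i')\<close> and push them to the left, so these heads stand
  at \<open>t - t'\<close> and \<open>i - i'\<close>.\<close>

definition outer :: "com \<Rightarrow> com" where "outer c = For 2 6 Right (For 3 7 Right c)"
definition inner :: "com \<Rightarrow> com" where "inner c = For 4 6 Left (For 5 7 Left c)"

text \<open>The loop order follows the vertex number,
  \<open>(t * W + i) * (2 * length gs) + a\<close> for the matrix row and likewise for the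
  column.\<close>

definition print_matrix :: "tm \<Rightarrow> letter list \<Rightarrow> com" where
  "print_matrix M gs = outer (unroll (2 * length gs) (\<lambda>a. inner (unroll (2 * length gs) (\<lambda>b.
     Emit (\<lambda>r. adj_bit M gs a b (undelta (r 6)) (undelta (r 7)) (r 2) (r 3) (r 4) (r 5))))))"

text \<open>Vertex count and threshold are constant multiples of the number of cells, so one sweep
  over all cells prints each of them.\<close>

definition print_unary :: "nat \<Rightarrow> com" where
  "print_unary n = outer (unroll n (\<lambda>_. Emit (\<lambda>_. True))) ;; Emit (\<lambda>_. False)"

definition print_instance :: "tm \<Rightarrow> letter list \<Rightarrow> com" where
  "print_instance M gs =
     print_unary (2 * length gs) ;; print_unary (length gs + 1) ;; print_matrix M gs"

lemma writes_below_print_instance: "writes_below 8 (print_instance M gs)"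
  by (simp add: print_instance_def print_unary_def print_matrix_def outer_def inner_def)

lemma concat_replicate_upt: "concat (map (\<lambda>_. replicate n x) [0..<m]) = replicate (m * n) x"
  by (induction m) (auto simp: replicate_add[symmetric] add.commute)

lemma does_print_unary:
  assumes "8 \<le> K" "spans (\<sigma> 2) W" "spans (\<sigma> 3) W"
  shows "does K (print_unary n) \<sigma> {1} (emits (replicate (W * W * n) True @ [False]))
    (sweep_time W (n * 1 + 1) + 1)"
proof -
  have E: "does K (Emit (\<lambda>_. b)) \<tau> {1} (emits [b]) 1" for b \<tau>
    using assms(1) by (intro does_Emit) auto
  have "does K (unroll n (\<lambda>_. Emit (\<lambda>_. True))) \<tau> {1} (emits (replicate n True)) (n * 1 + 1)" for \<tau>
    using does_unroll_emits[of n K "\<lambda>_. Emit (\<lambda>_. True)" \<tau> "\<lambda>_. [True]" 1] E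
      concat_replicate_upt[of 1 True n] by simp
  then have "does K (outer (unroll n (\<lambda>_. Emit (\<lambda>_. True)))) \<sigma> {1}
      (emits (concat (map (\<lambda>_. concat (map (\<lambda>_. replicate n True) [0..<W])) [0..<W]))) (sweep_time W (n * 1 + 1))"
    unfolding outer_def using assms by (intro does_For_For) auto
  then have "does K (outer (unroll n (\<lambda>_. Emit (\<lambda>_. True)))) \<sigma> {1}
      (emits (replicate (W * W * n) True)) (sweep_time W (n * 1 + 1))"
    by (simp add: concat_replicate_upt mult.assoc)
  from does_Seq[OF this E[of False]] show ?thesis
    unfolding print_unary_def by (simp add: emits_def o_def)
qed

lemma does_print_matrix:
  fixes gs :: "letter list"
  assumes "8 \<le> K" and \<sigma>: "\<And>j. j \<in> {2..5} \<Longrightarrow> \<sigma> j = (g, lo)" "\<And>j. j \<in> {6, 7} \<Longrightarrow> \<sigma> j = (delta, 0)"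
    and spans: "spans (g, lo) W"
  defines "n \<equiv> 2 * length gs"
  shows "does K (print_matrix M gs) \<sigma> {1}
    (emits (concat (map (\<lambda>t. concat (map (\<lambda>i. concat (map (\<lambda>a. concat (map (\<lambda>t'. concat (map (\<lambda>i'.
       map (\<lambda>b. adj_bit M gs a b (clip (int t - int t')) (clip (int i - int i'))
          (g (lo + int t)) (g (lo + int i)) (g (lo + int t')) (g (lo + int i')))
       [0..<n]) [0..<W])) [0..<W])) [0..<n])) [0..<W])) [0..<W])))
    (sweep_time W (n * sweep_time W (n * 1 + 1) + 1))"
  unfolding print_matrix_def outer_def n_def[symmetric]
proof (rule does_For_For, goal_cases)
  case (5 t i)
  let ?\<sigma> = "slide 3 7 Right (int i) (slide 2 6 Right (int t) \<sigma>)"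
  show ?case
    unfolding inner_def
  proof (rule does_unroll_emits, rule does_For_For, goal_cases)
    case (5 a t' i')
    let ?\<tau> = "slide 5 7 Left (int i') (slide 4 6 Left (int t') ?\<sigma>)"
    let ?b = "\<lambda>b r. adj_bit M gs a b (undelta (r 6)) (undelta (r 7)) (r 2) (r 3) (r 4) (r 5)"
    have reads: "reads K ?\<tau> 6 = delta (int t - int t')" "reads K ?\<tau> 7 = delta (int i - int i')"
      "reads K ?\<tau> 2 = g (lo + int t)" "reads K ?\<tau> 3 = g (lo + int i)"
      "reads K ?\<tau> 4 = g (lo + int t')" "reads K ?\<tau> 5 = g (lo + int i')"
      using assms(1) by (simp_all add: reads_def slide_def \<sigma> read_tape_eq)
    have "does K (Emit (?b b)) ?\<tau> {1} (emits [?b b (reads K ?\<tau>)]) 1" for b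
      using assms(1) by (intro does_Emit) auto
    then have "does K (unroll n (\<lambda>b. Emit (?b b))) ?\<tau> {1}
        (emits (concat (map (\<lambda>b. [?b b (reads K ?\<tau>)]) [0..<n]))) (n * 1 + 1)"
      by (intro does_unroll_emits)
    then show ?case
      by (simp add: reads undelta_delta)
  qed (use assms in \<open>auto simp: slide_def\<close>)
qed (use assms in auto)

definition tableau_cp :: "tm \<Rightarrow> letter list \<Rightarrow> (int \<Rightarrow> nat) \<Rightarrow> int \<Rightarrow> nat \<Rightarrow> nat \<Rightarrow> nat \<Rightarrow> nat \<Rightarrow> nat \<Rightarrow> bool" where
  "tableau_cp M gs g lo W s a s' b \<longleftrightarrow>
     compatible M (int (s div W) - int (s' div W)) (int (s mod W) - int (s' mod W))
       (g (lo + int (s div W))) (g (lo + int (s mod W))) (gs ! a)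
       (g (lo + int (s' div W))) (g (lo + int (s' mod W))) (gs ! b)"

lemma tableau_cp_sym: "tableau_cp M gs g lo W s a s' b \<Longrightarrow> tableau_cp M gs g lo W s' b s a"
  using compatible_sym[of M "int (s div W) - int (s' div W)" "int (s mod W) - int (s' mod W)"]
  unfolding tableau_cp_def by simp

lemma div_mod_eq_iff: "u = v \<longleftrightarrow> u div n = v div n \<and> u mod n = v mod (n :: nat)"
  by (metis div_mult_mod_eq)

lemma concat_map_nested3:
  "concat (map (\<lambda>x. concat (map (\<lambda>y. map (h x y) [0..<n]) [0..<m])) [0..<l]) =
   map (\<lambda>v. h (v div n div m) (v div n mod m) (v mod n)) [0..<l * m * n]"
  by (simp only: concat_concat_map[of "\<lambda>x y. map (h x y) [0..<n]"]
      concat_map_nested[of "\<lambda>s. h (s div m) (s mod m)"])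

lemma concat_concat_map3:
  "concat (map (\<lambda>x. concat (map (\<lambda>y. concat (map (h x y) [0..<n])) [0..<m])) [0..<l]) =
   concat (map (\<lambda>v. h (v div n div m) (v div n mod m) (v mod n)) [0..<l * m * n])"
  by (simp only: concat_concat_map[of "\<lambda>x y. concat (map (h x y) [0..<n])"]
      concat_concat_map[of "\<lambda>s. h (s div m) (s mod m)"])

text \<open>Flattening the six loops gives a row index \<open>u\<close> and a column index
  \<open>v\<close> whose quotients and remainders are the loop counters; clipping affects neither
  the zero tests nor \<open>compatible\<close>.\<close>

lemma print_instance_output:
  fixes gs :: "letter list"
  defines "n \<equiv> 2 * length gs" and "C \<equiv> length gs"
  shows "(replicate (W * W * n) True @ [False]) @ (replicate (W * W * (C + 1)) True @ [False]) @
    concat (map (\<lambda>t. concat (map (\<lambda>i. concat (map (\<lambda>a. concat (map (\<lambda>t'. concat (map (\<lambda>i'.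
       map (\<lambda>b. adj_bit M gs a b (clip (int t - int t')) (clip (int i - int i'))
          (g (lo + int t)) (g (lo + int i)) (g (lo + int t')) (g (lo + int i')))
       [0..<n]) [0..<W])) [0..<W])) [0..<n])) [0..<W])) [0..<W])
   = encode_instance (W * W * (2 * C)) (csp_edges (W * W) C (tableau_cp M gs g lo W)) (W * W * (C + 1))"
proof -
  let ?E = "csp_edges (W * W) C (tableau_cp M gs g lo W)"
  let ?b = "\<lambda>t i a t' i' b. adj_bit M gs a b (clip (int t - int t')) (clip (int i - int i'))
          (g (lo + int t)) (g (lo + int i)) (g (lo + int t')) (g (lo + int i'))"
  have bit: "?b (u div n div W) (u div n mod W) (u mod n) (v div n div W) (v div n mod W) (v mod n)
      \<longleftrightarrow> {u, v} \<in> ?E" if "u < W * W * n" "v < W * W * n" for u v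
  proof -
    have clip0: "clip (int x - int y) = 0 \<longleftrightarrow> x = y" for x y
      by (auto simp: clip_def)
    have "{u, v} \<in> ?E \<longleftrightarrow> csp_adj C (tableau_cp M gs g lo W) u v"
      using that tableau_cp_sym by (intro csp_edges_iff) (auto simp: n_def C_def)
    also have "\<dots> \<longleftrightarrow> ?b (u div n div W) (u div n mod W) (u mod n) (v div n div W) (v div n mod W) (v mod n)"
    proof -
      have "u div n = v div n \<longleftrightarrow> u div n div W = v div n div W \<and> u div n mod W = v div n mod W"
        by (rule div_mod_eq_iff)
      moreover have "u = v \<longleftrightarrow> u div n = v div n \<and> u mod n = v mod n"
        by (rule div_mod_eq_iff)
      ultimately show ?thesis
        unfolding csp_adj_def adj_bit_def tableau_cp_def compatible_clip clip0 C_def n_def[symmetric]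
        by (cases "length gs \<le> u mod n \<or> length gs \<le> v mod n") auto
    qed
    finally show ?thesis by simp
  qed
  have inner: "concat (map (\<lambda>t'. concat (map (\<lambda>i'. map (?b t i a t' i') [0..<n]) [0..<W])) [0..<W]) =
      map (\<lambda>v. ?b t i a (v div n div W) (v div n mod W) (v mod n)) [0..<W * W * n]" for t i a
    by (rule concat_map_nested3)
  have "concat (map (\<lambda>t. concat (map (\<lambda>i. concat (map (\<lambda>a. concat (map (\<lambda>t'. concat (map (\<lambda>i'.
       map (?b t i a t' i') [0..<n]) [0..<W])) [0..<W])) [0..<n])) [0..<W])) [0..<W]) =
    concat (map (\<lambda>u. map (\<lambda>v. ?b (u div n div W) (u div n mod W) (u mod n)
        (v div n div W) (v div n mod W) (v mod n)) [0..<W * W * n]) [0..<W * W * n])"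
    unfolding inner by (rule concat_concat_map3)
  also have "\<dots> = concat (map (\<lambda>u. map (\<lambda>v. {u, v} \<in> ?E) [0..<W * W * n]) [0..<W * W * n])"
    by (intro arg_cong[where f = concat] map_cong refl) (auto simp: bit)
  finally show ?thesis
    by (simp add: encode_instance_def n_def C_def)
qed

section \<open>Polynomial bounds\<close>

definition poly_bounded :: "(nat \<Rightarrow> nat) \<Rightarrow> bool" where
  "poly_bounded h \<longleftrightarrow> (\<exists>p :: nat poly. \<forall>n. h n \<le> poly p n)"

lemma poly_bounded_const: "poly_bounded (\<lambda>_. k)"
  unfolding poly_bounded_def by (intro exI[of _ "[:k:]"]) auto

lemma poly_bounded_max: "poly_bounded (\<lambda>n. max 1 n)"
  unfolding poly_bounded_def by (intro exI[of _ "[:1, 1:]"]) auto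

lemma poly_bounded_add: "poly_bounded f \<Longrightarrow> poly_bounded h \<Longrightarrow> poly_bounded (\<lambda>n. f n + h n)"
  unfolding poly_bounded_def by (metis add_mono poly_add)

lemma poly_bounded_mult: "poly_bounded f \<Longrightarrow> poly_bounded h \<Longrightarrow> poly_bounded (\<lambda>n. f n * h n)"
  unfolding poly_bounded_def by (metis mult_le_mono poly_mult)

lemma poly_bounded_power: "poly_bounded f \<Longrightarrow> poly_bounded (\<lambda>n. f n ^ k)"
  by (induction k) (auto intro: poly_bounded_mult poly_bounded_const)

lemmas poly_bounded_intros =
  poly_bounded_const poly_bounded_max poly_bounded_add poly_bounded_mult poly_bounded_power

lemma poly_bounded_nest_time:
  "poly_bounded f \<Longrightarrow> poly_bounded h \<Longrightarrow> poly_bounded (\<lambda>n. nest_time (f n) (h n) k)"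
  by (induction k; simp; intro poly_bounded_intros; assumption)

text \<open>Horner's scheme raises the exponent by one per coefficient. This is the form that nested
  loops can count, and \<open>0 < d\<close> provides the counter tape 8 that
  \<open>rewind_unary\<close> watches.\<close>

lemma poly_less_monomial:
  fixes p :: "nat poly"
  shows "\<exists>c d. 0 < d \<and> (\<forall>n. poly p n < c * max 1 n ^ d)"
proof (induction p)
  case 0
  show ?case by (intro exI[of _ 1]) auto
next
  case (pCons a p)
  then obtain c d where cd: "0 < d" "\<And>n. poly p n < c * max 1 n ^ d" by blast
  have "poly (pCons a p) n < (a + c) * max 1 n ^ Suc d" for n
  proof -
    define U where "U = max 1 n"
    have U: "1 \<le> U" "n \<le> U" by (auto simp: U_def)
    have "a * 1 \<le> a * U ^ Suc d"
      using U by (intro mult_left_mono one_le_power) auto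
    moreover have "n * poly p n \<le> U * poly p n" using U by (intro mult_right_mono) auto
    moreover have "U * poly p n < U * (c * U ^ d)"
      using cd(2)[of n] U unfolding U_def[symmetric] by (intro mult_strict_left_mono) auto
    ultimately have "a + n * poly p n < a * U ^ Suc d + U * (c * U ^ d)" by linarith
    then show ?thesis unfolding U_def[symmetric] by (simp add: algebra_simps)
  qed
  then show ?case using cd(1) by blast
qed

section \<open>Assembling the reduction\<close>

lemma coordinates_ruler:
  assumes "U = max 1 (length w)"
  shows "coordinates w (ruler w U Q) (- int Q - 1) (int U + int Q)"
  unfolding coordinates_def
proof
  fix i assume "i \<in> {- int Q - 1..<int U + int Q}"
  with assms word_tape_le[of w i]
  show "decode (ruler w U Q i) = word_tape w i \<and> (ruler w U Q i \<in> {4, 5, 6} \<longleftrightarrow> i = 0) \<and>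
      (ruler w U Q i = 7 \<longleftrightarrow> i = - int Q - 1)"
    by (auto simp: ruler_def coded_def decode_def word_tape_def)
qed

lemma spans_ruler:
  assumes "1 \<le> U"
  shows "spans (ruler w U Q, - int Q - 1) (U + 2 * Q + 1)"
proof -
  have "word_tape w i + (if i = 0 then 4 else 1) \<noteq> 0" for i by auto
  then show ?thesis
    using assms unfolding spans_def ruler_def coded_def by auto
qed

text \<open>Variable \<open>s\<close> is the cell in row \<open>s div W\<close> and column
  \<open>s mod W\<close>, counted from \<open>lo\<close>; its value is an index into the list of
  letters.\<close>

lemma csp_solution_iff_valid_tableau:
  assumes gs: "set gs = letters M G" and W: "0 < W"
  shows "(\<exists>x. (\<forall>s<W * W. x s < length gs) \<and> (\<forall>s<W * W. \<forall>s'<W * W. s \<noteq> s' \<longrightarrow>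
       tableau_cp M gs g lo W s (x s) s' (x s'))) \<longleftrightarrow> (\<exists>X. valid_tableau M G g lo (lo + int W) X)"
proof
  assume "\<exists>x. (\<forall>s<W * W. x s < length gs) \<and> (\<forall>s<W * W. \<forall>s'<W * W. s \<noteq> s' \<longrightarrow>
       tableau_cp M gs g lo W s (x s) s' (x s'))"
  then obtain x where x: "\<forall>s<W * W. x s < length gs"
    "\<forall>s<W * W. \<forall>s'<W * W. s \<noteq> s' \<longrightarrow> tableau_cp M gs g lo W s (x s) s' (x s')"
    by (elim exE conjE)
  define cell where "cell t i = nat (t - lo) * W + nat (i - lo)" for t i
  have cell: "cell t i < W * W" "lo + int (cell t i div W) = t" "lo + int (cell t i mod W) = i"
    if "t \<in> {lo..<lo + int W}" "i \<in> {lo..<lo + int W}" for t i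
  proof -
    have "nat (i - lo) < W" "nat (t - lo) < W" using that by auto
    then show "cell t i < W * W" "lo + int (cell t i div W) = t" "lo + int (cell t i mod W) = i"
      using that unfolding cell_def by (auto simp: mult_add_less mult_add_div_mod)
  qed
  have "valid_tableau M G g lo (lo + int W) (\<lambda>t i. gs ! x (cell t i))"
    unfolding valid_tableau_def
  proof (intro conjI ballI impI)
    fix t i assume "t \<in> {lo..<lo + int W}" "i \<in> {lo..<lo + int W}"
    then show "gs ! x (cell t i) \<in> letters M G"
      using x(1) cell(1) gs nth_mem by blast
  next
    fix t i t' i' assume r: "t \<in> {lo..<lo + int W}" "i \<in> {lo..<lo + int W}"
      "t' \<in> {lo..<lo + int W}" "i' \<in> {lo..<lo + int W}" and ne: "(t, i) \<noteq> (t', i')"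
    note c = cell[OF r(1,2)] and c' = cell[OF r(3,4)]
    have "cell t i \<noteq> cell t' i'" using ne c(2,3) c'(2,3) by metis
    then have "tableau_cp M gs g lo W (cell t i) (x (cell t i)) (cell t' i') (x (cell t' i'))"
      using x(2) c(1) c'(1) by blast
    moreover have "int (cell t i div W) = t - lo" "int (cell t i mod W) = i - lo"
      "int (cell t' i' div W) = t' - lo" "int (cell t' i' mod W) = i' - lo"
      using c c' by linarith+
    ultimately show "compatible M (t - t') (i - i') (g t) (g i) (gs ! x (cell t i)) (g t') (g i') (gs ! x (cell t' i'))"
      unfolding tableau_cp_def by simp
  qed
  then show "\<exists>X. valid_tableau M G g lo (lo + int W) X" by blast
next
  assume "\<exists>X. valid_tableau M G g lo (lo + int W) X"
  then obtain X where X: "valid_tableau M G g lo (lo + int W) X" by blast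
  define t i where "t s = lo + int (s div W)" and "i s = lo + int (s mod W)" for s
  have r: "t s \<in> {lo..<lo + int W}" "i s \<in> {lo..<lo + int W}" if "s < W * W" for s
    using that W by (auto simp: t_def i_def less_mult_imp_div_less)
  have "\<forall>s. s < W * W \<longrightarrow> (\<exists>a. a < length gs \<and> gs ! a = X (t s) (i s))"
    using X r gs unfolding valid_tableau_def by (metis in_set_conv_nth)
  then obtain x where x: "\<And>s. s < W * W \<Longrightarrow> x s < length gs"
    "\<And>s. s < W * W \<Longrightarrow> gs ! x s = X (t s) (i s)" by metis
  have "tableau_cp M gs g lo W s (x s) s' (x s')" if s: "s < W * W" "s' < W * W" "s \<noteq> s'" for s s'
  proof -
    have "(t s, i s) \<noteq> (t s', i s')"
      using s(3) div_mod_eq_iff[of s s' W] by (auto simp: t_def i_def)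
    from valid_tableau_compatible[OF X r[OF s(1)] r[OF s(2)] this]
    show ?thesis
      by (simp add: tableau_cp_def x s t_def[symmetric] i_def[symmetric]) (simp add: t_def i_def)
  qed
  with x(1) show "\<exists>x. (\<forall>s<W * W. x s < length gs) \<and> (\<forall>s<W * W. \<forall>s'<W * W. s \<noteq> s' \<longrightarrow>
       tableau_cp M gs g lo W s (x s) s' (x s'))"
    by (intro exI[of _ x]) auto
qed

text \<open>A tableau with \<open>U + 2 * Q + 1\<close> rows is built from a run of that many steps
  but gives back a run of one step less. Both lengths exceed the time bound, so the criterion for
  padded runs applies to each.\<close>

lemma accepts_iff_valid_tableau:
  assumes dec: "decides_in_time M A T" and wf: "tm_wf M" "symbols_below M G"
    and U: "U = max 1 (length w)" and Q: "T (length w) < Q"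
  shows "w \<in> A \<longleftrightarrow> (\<exists>X. valid_tableau M G (ruler w U Q) (- int Q - 1) (- int Q - 1 + int (U + 2 * Q + 1)) X)"
proof -
  let ?g = "ruler w U Q" and ?lo = "- int Q - 1" and ?W = "U + 2 * Q + 1"
  have coords: "coordinates w ?g ?lo (?lo + int ?W)"
    using coordinates_ruler[OF U, of Q] by (simp add: algebra_simps)
  have time: "\<forall>m c. (step M ^^ m) (init_config M w) c \<longrightarrow> m \<le> T (length w)"
    using dec unfolding decides_in_time_def by blast
  show ?thesis
  proof
    assume "w \<in> A"
    moreover have "T (length w) < ?W" using Q by simp
    ultimately obtain c where "(step (padded M G) ^^ ?W) (init_config M w) c"
      using accepts_iff_padded_run[OF dec wf] by blast
    moreover have "nat (?lo + int ?W - ?lo) = ?W" by simp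
    ultimately have "(step (padded M G) ^^ nat (?lo + int ?W - ?lo)) (init_config M w) c"
      by (simp only:)
    from run_valid_tableau[OF wf coords this] show "\<exists>X. valid_tableau M G ?g ?lo (?lo + int ?W) X" .
  next
    assume "\<exists>X. valid_tableau M G ?g ?lo (?lo + int ?W) X"
    then obtain X where X: "valid_tableau M G ?g ?lo (?lo + int ?W) X" by blast
    have "\<exists>c. (step (padded M G) ^^ (U + 2 * Q)) (init_config M w) c"
    proof -
      have "?lo < - int (T (length w))" "int (T (length w)) < ?lo + int ?W"
        "int (U + 2 * Q) < ?lo + int ?W - ?lo" using Q by simp_all
      from valid_tableau_run[OF wf time this(1,2) coords X this(3)] show ?thesis by blast
    qed
    then show "w \<in> A"
      using accepts_iff_padded_run[OF dec wf, of w "U + 2 * Q"] Q by auto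
  qed
qed

theorem theorem6p2: "NP_hard MONOPHONIC_POSITION_SET"
  unfolding NP_hard_def
proof
  fix A assume "A \<in> NP"
  then obtain M and p :: "nat poly" where wf: "tm_wf M" and dec: "decides_in_time M A (poly p)"
    by (auto simp: NP_def)
  obtain G where G: "symbols_below M G" using ex_symbols_below[OF wf] by blast
  obtain gs where gs: "set gs = letters M G" using finite_list[OF finite_letters[OF wf]] by blast
  obtain c d where cd: "0 < d" "\<And>n. poly p n < c * max 1 n ^ d" using poly_less_monomial by metis
  define C where "C = length gs"
  define U where "U n = max 1 n" for n :: nat
  define Q where "Q n = c * U n ^ d" for n
  define W where "W n = U n + 2 * Q n + 1" for n
  define cp where "cp w = tableau_cp M gs (ruler w (U (length w)) (Q (length w))) (- int (Q (length w)) - 1) (W (length w))"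
    for w
  define f where "f w = (let R = W (length w) * W (length w) in
      encode_instance (R * (2 * C)) (csp_edges R C (cp w)) (R * (C + 1)))" for w
  have "w \<in> A \<longleftrightarrow> f w \<in> MONOPHONIC_POSITION_SET" for w
  proof -
    let ?n = "length w"
    have "f w \<in> MONOPHONIC_POSITION_SET \<longleftrightarrow> (\<exists>x. (\<forall>s<W ?n * W ?n. x s < length gs) \<and>
        (\<forall>s<W ?n * W ?n. \<forall>s'<W ?n * W ?n. s \<noteq> s' \<longrightarrow> cp w s (x s) s' (x s')))"
      unfolding f_def Let_def C_def by (rule csp_instance_iff) (auto simp: W_def cp_def intro: tableau_cp_sym)
    also have "\<dots> \<longleftrightarrow> (\<exists>X. valid_tableau M G (ruler w (U ?n) (Q ?n)) (- int (Q ?n) - 1) (- int (Q ?n) - 1 + int (W ?n)) X)"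
      unfolding cp_def by (rule csp_solution_iff_valid_tableau[OF gs]) (simp add: W_def)
    also have "\<dots> \<longleftrightarrow> w \<in> A"
      unfolding W_def
      by (rule accepts_iff_valid_tableau[OF dec wf G, symmetric]) (use cd in \<open>simp_all add: U_def Q_def\<close>)
    finally show ?thesis by simp
  qed
  moreover have "polytime_computable f"
  proof -
    \<comment> \<open>The summands are the preparation of the tapes, the vertex count, the threshold
      and the matrix.\<close>
    define T where "T n = (9 * U n + 3 * Q n + 2 * nest_time (U n) (c + 1) d + 10) +
       ((sweep_time (W n) (2 * C * 1 + 1) + 1) + ((sweep_time (W n) ((C + 1) * 1 + 1) + 1) +
        sweep_time (W n) (2 * C * sweep_time (W n) (2 * C * 1 + 1) + 1)))" for n
    have "poly_bounded T"
      unfolding T_def W_def Q_def U_def sweep_time_def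
      by (intro poly_bounded_intros poly_bounded_nest_time)
    then obtain q where q: "\<And>n. T n \<le> poly q n" by (auto simp: poly_bounded_def)
    show ?thesis
    proof (rule polytime_computableI[where K = "8 + d" and G = 8 and c = "prepare c d ;; print_instance M gs" and p = q])
      show "writes_below 8 (prepare c d ;; print_instance M gs)"
        by (simp add: writes_below_prepare writes_below_print_instance)
      fix w :: "bool list"
      let ?n = "length w"
      let ?g = "ruler w (U ?n) (Q ?n)" and ?lo = "- int (Q ?n) - 1"
      let ?\<sigma> = "store d (word_tape w, int (U ?n)) (?g, ?lo) (delta, 0) (unary (U ?n), 0)"
      have prep: "runs (8 + d) (prepare c d) (start_store w) ?\<sigma>
          (9 * U ?n + 3 * Q ?n + 2 * nest_time (U ?n) (c + 1) d + 10)"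
        unfolding U_def Q_def by (rule runs_prepare[OF cd(1)])
      have spans: "spans (?g, ?lo) (W ?n)"
        unfolding W_def by (rule spans_ruler) (simp add: U_def)
      have "does (8 + d) (print_instance M gs) ?\<sigma> {1} (emits (f w))
          ((sweep_time (W ?n) (2 * C * 1 + 1) + 1) + ((sweep_time (W ?n) ((C + 1) * 1 + 1) + 1) +
            sweep_time (W ?n) (2 * C * sweep_time (W ?n) (2 * C * 1 + 1) + 1)))"
      proof -
        have emits: "emits v \<circ> emits u = emits (u @ v)" for u v by (simp add: emits_def)
        have 1: "does (8 + d) (print_unary k) ?\<sigma> {1} (emits (replicate (W ?n * W ?n * k) True @ [False]))
            (sweep_time (W ?n) (k * 1 + 1) + 1)" for k
          using spans by (intro does_print_unary) (simp_all add: store_def)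
        have 2: "\<And>j. j \<in> {2..5} \<Longrightarrow> ?\<sigma> j = (?g, ?lo)" "\<And>j. j \<in> {6, 7} \<Longrightarrow> ?\<sigma> j = (delta, 0)"
          by (auto simp: store_def)
        have "8 \<le> 8 + d" by simp
        note does_print_matrix[where gs = gs and M = M, OF this 2 spans]
        from does_Seq[OF 1[of "2 * C"] does_Seq[OF 1[of "C + 1"] this]]
        show ?thesis
          unfolding print_instance_def f_def Let_def cp_def C_def emits append_assoc
            print_instance_output[symmetric] by simp
      qed
      then have "runs (8 + d) (print_instance M gs) ?\<sigma> (on_tapes {1} (emits (f w)) ?\<sigma>)
          ((sweep_time (W ?n) (2 * C * 1 + 1) + 1) + ((sweep_time (W ?n) ((C + 1) * 1 + 1) + 1) +
            sweep_time (W ?n) (2 * C * sweep_time (W ?n) (2 * C * 1 + 1) + 1)))"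
        by (simp add: does_def)
      from runs_mono[OF runs_Seq[OF prep this]] q[of ?n]
      have "runs (8 + d) (prepare c d ;; print_instance M gs) (start_store w)
          (on_tapes {1} (emits (f w)) ?\<sigma>) (poly q ?n)"
        by (simp add: T_def)
      moreover have "fst (on_tapes {1} (emits (f w)) ?\<sigma> 1) = word_tape (f w)"
        using emits_word_tape[of "f w" "[]"] by (simp add: on_tapes_def store_def)
      ultimately show "\<exists>\<sigma>. runs (8 + d) (prepare c d ;; print_instance M gs) (start_store w) \<sigma> (poly q ?n) \<and>
          fst (\<sigma> 1) = word_tape (f w)" by blast
    qed simp_all
  qed
  ultimately show "polytime_reducible A MONOPHONIC_POSITION_SET"
    unfolding polytime_reducible_def by blast
qed

end
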